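(* Let $\Gamma$ be a finitely generated infinite group, $K$ a symmetric finite generating subset of $\Gamma$, $m$ a symmetric weight on $K$, $1<p<\infty$, and $q=p/(p-1)$ the conjugate exponent of $p$. Let $\lambda_{\Gamma,p}$ be the left regular representation of $\Gamma$ on $\ell^p(\Gamma)$ and let $\mathcal{A}(\lambda_{\Gamma,p})$ be the set of affine isometric actions of $\Gamma$ on $\ell^p(\Gamma)$ whose linear part is $\lambda_{\Gamma,p}$. Then the following are equivalent. (i) Every $\alpha\in\mathcal{A}(\lambda_{\Gamma,p})$ has a fixed point. (ii) There is a constant $C>0$ such that every $f\in D_p(\Gamma)$ satisfies $\|\Delta_pf\|_{\ell^q(\Gamma)}\ge C\|f\|_{D_p(\Gamma)}^{p-1}$.
   Context: Functions are complex-valued. $K$ symmetric means $K^{-1}=K$; a symmetric weight on $K$ is a function $m:K\to(0,\infty)$ with $\sum_{\gamma\in K}m(\gamma)=1$ and $m(\gamma)=m(\gamma^{-1})$. For $f:\Gamma\to\mathbb{C}$ put $(\lambda_\Gamma(\gamma)f)(\gamma')=f(\gamma^{-1}\gamma')$ and $df(\gamma)=\lambda_\Gamma(\gamma)f-f$ (a function on $\Gamma$); $\lambda_{\Gamma,p}$ is the restriction of $\lambda_\Gamma$ to $\ell^p(\Gamma)$, with norm $\|f\|_{\ell^p(\Gamma)}=(\sum_{\gamma\in\Gamma}|f(\gamma)|^p)^{1/p}$. An affine isometric action with linear part $\lambda_{\Gamma,p}$ is an action of the form $\alpha(\gamma,f)=\lambda_{\Gamma,p}(\gamma)f+c(\gamma)$,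 where $c:\Gamma\to\ell^p(\Gamma)$ satisfies $c(\gamma\gamma')=\lambda_{\Gamma,p}(\gamma)c(\gamma')+c(\gamma)$ for all $\gamma,\gamma'\in\Gamma$; a fixed point is $f\in\ell^p(\Gamma)$ with $\alpha(\gamma,f)=f$ for all $\gamma\in\Gamma$. The space of $p$-Dirichlet finite functions is $D_p(\Gamma)=\{f:\Gamma\to\mathbb{C} : df(\gamma)\in\ell^p(\Gamma)\text{ for all }\gamma\in K\}$, and for $f\in D_p(\Gamma)$, $$\|f\|_{D_p(\Gamma)}=\Big(\sum_{\gamma\in K}\|df(\gamma)\|_{\ell^p(\Gamma)}^p\,m(\gamma)\Big)^{1/p}$$ (a norm modulo constant functions). The $p$-Laplacian of $f\in D_p(\Gamma)$ is $$\Delta_pf(x)=\sum_{\gamma\in K}|df(\gamma)(x)|^{p-2}\,df(\gamma)(x)\,m(\gamma)\quad(x\in\Gamma),$$ where for $p<2$ one sets $|df(\gamma)(x)|^{p-2}=0$ whenever $df(\gamma)(x)=0$. *)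

theory Defs
  imports "HOL-Analysis.Analysis" "HOL-Algebra.Algebra"
begin

text \<open>
  A function from a group \<open>G\<close> to the complex numbers is an element of
  \<open>carrier G \<rightarrow>\<^sub>E UNIV\<close>, so that equality in HOL is equality on the carrier.
\<close>

definition left_reg :: "('a, 'b) monoid_scheme \<Rightarrow> 'a \<Rightarrow> ('a \<Rightarrow> complex) \<Rightarrow> 'a \<Rightarrow> complex"
  where "left_reg G \<gamma> f = (\<lambda>x\<in>carrier G. f (inv\<^bsub>G\<^esub> \<gamma> \<otimes>\<^bsub>G\<^esub> x))"

definition diff_fun :: "('a, 'b) monoid_scheme \<Rightarrow> ('a \<Rightarrow> complex) \<Rightarrow> 'a \<Rightarrow> 'a \<Rightarrow> complex"
  where "diff_fun G f \<gamma> = (\<lambda>x\<in>carrier G. left_reg G \<gamma> f x - f x)"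

definition ell :: "('a, 'b) monoid_scheme \<Rightarrow> real \<Rightarrow> ('a \<Rightarrow> complex) set"
  where "ell G p =
    {f \<in> carrier G \<rightarrow>\<^sub>E UNIV. (\<lambda>x. cmod (f x) powr p) summable_on carrier G}"

definition ell_norm :: "('a, 'b) monoid_scheme \<Rightarrow> real \<Rightarrow> ('a \<Rightarrow> complex) \<Rightarrow> real"
  where "ell_norm G p f = (\<Sum>\<^sub>\<infinity>x\<in>carrier G. cmod (f x) powr p) powr (1 / p)"

definition cocycles :: "('a, 'b) monoid_scheme \<Rightarrow> real \<Rightarrow> ('a \<Rightarrow> 'a \<Rightarrow> complex) set"
  where "cocycles G p =
    {c \<in> carrier G \<rightarrow> ell G p. \<forall>\<gamma>\<in>carrier G. \<forall>\<gamma>'\<in>carrier G.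
        c (\<gamma> \<otimes>\<^bsub>G\<^esub> \<gamma>') = (\<lambda>x\<in>carrier G. left_reg G \<gamma> (c \<gamma>') x + c \<gamma> x)}"

text \<open>
  Isometry is not a separate clause: it is automatic, since left translation preserves the
  \<open>p\<close>-norm.
\<close>

definition affine_actions ::
    "('a, 'b) monoid_scheme \<Rightarrow> real \<Rightarrow> ('a \<Rightarrow> ('a \<Rightarrow> complex) \<Rightarrow> 'a \<Rightarrow> complex) set"
  where "affine_actions G p =
    {\<alpha>. group_action G (ell G p) \<alpha> \<and>
        (\<exists>c\<in>cocycles G p. \<forall>\<gamma>\<in>carrier G. \<forall>f\<in>ell G p.
            \<alpha> \<gamma> f = (\<lambda>x\<in>carrier G. left_reg G \<gamma> f x + c \<gamma> x))}"

definition dirichlet_space ::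
    "('a, 'b) monoid_scheme \<Rightarrow> 'a set \<Rightarrow> real \<Rightarrow> ('a \<Rightarrow> complex) set"
  where "dirichlet_space G K p =
    {f \<in> carrier G \<rightarrow>\<^sub>E UNIV. \<forall>\<gamma>\<in>K. diff_fun G f \<gamma> \<in> ell G p}"

definition dirichlet_norm ::
    "('a, 'b) monoid_scheme \<Rightarrow> 'a set \<Rightarrow> ('a \<Rightarrow> real) \<Rightarrow> real \<Rightarrow> ('a \<Rightarrow> complex) \<Rightarrow> real"
  where "dirichlet_norm G K m p f =
    (\<Sum>\<gamma>\<in>K. ell_norm G p (diff_fun G f \<gamma>) powr p * m \<gamma>) powr (1 / p)"

text \<open>
  Since \<open>0 powr a = 0\<close> for every \<open>a\<close>, the convention for \<open>p < 2\<close> at zeros of the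
  difference is built in. For \<open>p = 2\<close> the value \<open>0 powr 0 = 0\<close> is harmless, as it is
  multiplied by \<open>0\<close>.
\<close>

definition p_laplacian ::
    "('a, 'b) monoid_scheme \<Rightarrow> 'a set \<Rightarrow> ('a \<Rightarrow> real) \<Rightarrow> real \<Rightarrow> ('a \<Rightarrow> complex) \<Rightarrow> 'a \<Rightarrow> complex"
  where "p_laplacian G K m p f =
    (\<lambda>x\<in>carrier G. \<Sum>\<gamma>\<in>K.
        of_real (cmod (diff_fun G f \<gamma> x) powr (p - 2)) * diff_fun G f \<gamma> x * of_real (m \<gamma>))"

definition symmetric_weight :: "('a, 'b) monoid_scheme \<Rightarrow> 'a set \<Rightarrow> ('a \<Rightarrow> real) \<Rightarrow> bool"
  where "symmetric_weight G K m \<longleftrightarrow>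
    (\<forall>\<gamma>\<in>K. m \<gamma> > 0) \<and> (\<Sum>\<gamma>\<in>K. m \<gamma>) = 1 \<and> (\<forall>\<gamma>\<in>K. m (inv\<^bsub>G\<^esub> \<gamma>) = m \<gamma>)"

end

theory Submission
  imports Defs
begin

text \<open>
  Every cocycle has the form \<open>\<gamma> \<mapsto> dF(\<gamma>)\<close> with \<open>F\<close> a \<open>p\<close>-Dirichlet finite function, namely
  \<open>F(x) = - c(x)(x)\<close>, so the fixed point property says that every \<open>p\<close>-Dirichlet finite function is a
  constant plus an element of \<open>\<ell>\<^sup>p\<close>. Let the energy \<open>E(f)\<close> be the \<open>p\<close>-th power of the
  Dirichlet norm.

  If the fixed point property holds, then \<open>\<parallel>f\<parallel>\<^sub>p\<^sup>p \<le> C E(f)\<close> on \<open>\<ell>\<^sup>p\<close>: otherwise a sum of right translates,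
  with disjoint supports, of finitely supported functions of \<open>p\<close>-norm \<open>1\<close> and rapidly decreasing energy
  is \<open>p\<close>-Dirichlet finite but not in \<open>\<ell>\<^sup>p\<close> modulo constants. Green's formula
  \<open>E(f) = - 2 \<langle>\<Delta>\<^sub>p f, f\<rangle>\<close> and Hoelder's inequality then bound the \<open>p\<close>-Laplacian from below.

  Conversely, \<open>- 2p \<Delta>\<^sub>p f\<close> is the gradient of the energy, so the lower bound on the \<open>p\<close>-Laplacian says that
  the function \<open>h \<mapsto> E(F + h)\<^bsup>1/p\<^esup>\<close> on the complete metric space \<open>\<ell>\<^sup>p\<close> has slope bounded away from \<open>0\<close> wherever it
  does not vanish. By Ekeland's variational principle it vanishes at some \<open>h\<close>, which is the fixed point.
\<close>

section \<open>Sums of p-th powers\<close>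

lemma nonneg_finite_sums_bounded:
  fixes f :: "'a \<Rightarrow> real"
  assumes "\<And>x. x \<in> A \<Longrightarrow> 0 \<le> f x" "\<And>F. finite F \<Longrightarrow> F \<subseteq> A \<Longrightarrow> sum f F \<le> b"
  shows "f summable_on A" "infsum f A \<le> b"
proof -
  show "f summable_on A"
    using assms by (intro nonneg_bdd_above_summable_on bdd_aboveI2[where M = b]) auto
  then show "infsum f A \<le> b"
    using assms(2) by (rule infsum_le_finite_sums)
qed

lemma has_sum_sum:
  fixes f :: "'i \<Rightarrow> 'a \<Rightarrow> 'b :: topological_comm_monoid_add"
  assumes "\<And>i. i \<in> I \<Longrightarrow> (f i has_sum s i) A"
  shows "((\<lambda>x. \<Sum>i\<in>I. f i x) has_sum (\<Sum>i\<in>I. s i)) A"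
  using assms by (induction I rule: infinite_finite_induct) (auto intro: has_sum_add)

text \<open>A crude substitute for convexity: passing through the maximum works for every
  \<open>p > 0\<close>, at the price of the factor \<open>2 powr p\<close>. It serves wherever only
  summability or the existence of some constant matters.\<close>

lemma cmod_add_powr_le:
  assumes "p > 0"
  shows "cmod (a + b) powr p \<le> 2 powr p * (cmod a powr p + cmod b powr p)"
proof -
  have "cmod (a + b) \<le> 2 * max (cmod a) (cmod b)"
    using norm_triangle_ineq[of a b] by linarith
  then have "cmod (a + b) powr p \<le> (2 * max (cmod a) (cmod b)) powr p"
    using assms by (intro powr_mono2) auto
  also have "\<dots> = 2 powr p * max (cmod a) (cmod b) powr p"
    by (simp add: powr_mult)
  also have "\<dots> \<le> 2 powr p * (cmod a powr p + cmod b powr p)"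
    by (intro mult_left_mono) (auto simp: max_def)
  finally show ?thesis .
qed

lemma summable_on_powr_add:
  fixes f g :: "'a \<Rightarrow> complex"
  assumes "p > 0" "(\<lambda>x. cmod (f x) powr p) summable_on A" "(\<lambda>x. cmod (g x) powr p) summable_on A"
  shows "(\<lambda>x. cmod (f x + g x) powr p) summable_on A"
  by (rule summable_on_comparison_test[OF
        summable_on_cmult_right[OF summable_on_add[OF assms(2,3)], of "2 powr p"]])
     (use cmod_add_powr_le[OF assms(1)] in auto)

lemma summable_on_powr_diff:
  fixes f g :: "'a \<Rightarrow> complex"
  assumes "p > 0" "(\<lambda>x. cmod (f x) powr p) summable_on A" "(\<lambda>x. cmod (g x) powr p) summable_on A"
  shows "(\<lambda>x. cmod (f x - g x) powr p) summable_on A"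
  using summable_on_powr_add[of p f A "\<lambda>x. - g x"] assms by simp

section \<open>Convexity and the inequalities of Minkowski and Hoelder for infinite sums\<close>

lemma powr_convex_combination:
  fixes a b s t :: real
  assumes "p \<ge> 1" "a \<ge> 0" "b \<ge> 0" "s \<ge> 0" "t \<ge> 0" "s + t = 1"
  shows "(s * a + t * b) powr p \<le> s * a powr p + t * b powr p"
proof -
  \<comment> \<open>This settles the boundary cases: if \<open>a\<close> or \<open>b\<close> is 0,
    the claim reduces to this bound for the weight of the other.\<close>
  have *: "r powr p \<le> r" if "0 \<le> r" "r \<le> 1" for r :: real
    using powr_mono_both[of 1 p r 1] powr_mono'[of 1 p r] that assms(1) by simp
  consider "a = 0" | "b = 0" | "a > 0" "b > 0"
    using assms by linarith
  then show ?thesis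
  proof cases
    case 1
    then show ?thesis using *[of t] assms by (simp add: powr_mult mult_right_mono)
  next
    case 2
    then show ?thesis using *[of s] assms by (simp add: powr_mult mult_right_mono)
  next
    case 3
    have t: "s = 1 - t" using assms by simp
    show ?thesis
      using convex_onD[OF powr_convex[OF assms(1)], of t a b] 3 assms unfolding t by simp
  qed
qed

lemma Minkowski_infsum:
  fixes f g :: "'a \<Rightarrow> complex"
  assumes p: "p \<ge> 1" and f: "(\<lambda>x. cmod (f x) powr p) summable_on A"
    and g: "(\<lambda>x. cmod (g x) powr p) summable_on A"
  shows "(\<Sum>\<^sub>\<infinity>x\<in>A. cmod (f x + g x) powr p) powr (1 / p)
     \<le> (\<Sum>\<^sub>\<infinity>x\<in>A. cmod (f x) powr p) powr (1 / p) + (\<Sum>\<^sub>\<infinity>x\<in>A. cmod (g x) powr p) powr (1 / p)"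
proof -
  let ?F = "\<Sum>\<^sub>\<infinity>x\<in>A. cmod (f x) powr p" and ?G = "\<Sum>\<^sub>\<infinity>x\<in>A. cmod (g x) powr p"
  define a b where "a = ?F powr (1 / p)" and "b = ?G powr (1 / p)"
  have F0: "?F \<ge> 0" and G0: "?G \<ge> 0" by (simp_all add: infsum_nonneg)
  have ap: "a powr p = ?F" and bp: "b powr p = ?G"
    using F0 G0 p by (simp_all add: a_def b_def powr_powr)
  have ab: "a \<ge> 0" "b \<ge> 0" by (simp_all add: a_def b_def)
  show ?thesis
  proof (cases "a = 0 \<or> b = 0")
    case True
    then show ?thesis
    proof
      assume "a = 0"
      then have "?F \<le> 0" using ap by simp
      then have "cmod (f x) powr p = 0" if "x \<in> A" for x
        using nonneg_infsum_le_0D[OF _ f, of x] that by simp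
      then have "cmod (f x + g x) powr p = cmod (g x) powr p" if "x \<in> A" for x
        using that by simp
      then have "(\<Sum>\<^sub>\<infinity>x\<in>A. cmod (f x + g x) powr p) = ?G"
        by (intro infsum_cong)
      then show ?thesis by simp
    next
      assume "b = 0"
      then have "?G \<le> 0" using bp by simp
      then have "cmod (g x) powr p = 0" if "x \<in> A" for x
        using nonneg_infsum_le_0D[OF _ g, of x] that by simp
      then have "cmod (f x + g x) powr p = cmod (f x) powr p" if "x \<in> A" for x
        using that by simp
      then have "(\<Sum>\<^sub>\<infinity>x\<in>A. cmod (f x + g x) powr p) = ?F"
        by (intro infsum_cong)
      then show ?thesis by simp
    qed
  next
    case False
    with ab have pos: "a > 0" "b > 0" by auto
    \<comment> \<open>Convexity is applied to the normalized values |f x| / a and |g x| / b with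
      weights a / (a + b) and b / (a + b). After summation the bracket becomes the sum of the
      weights, which is 1.\<close>
    have le: "cmod (f x + g x) powr p
        \<le> (a + b) powr p * (a / (a + b) / ?F * cmod (f x) powr p + b / (a + b) / ?G * cmod (g x) powr p)" for x
    proof -
      have "cmod (f x + g x) \<le> cmod (f x) + cmod (g x)" by (rule norm_triangle_ineq)
      also have "\<dots> = (a + b) * (a / (a + b) * (cmod (f x) / a) + b / (a + b) * (cmod (g x) / b))"
      proof -
        have "(a + b) * (a / (a + b) * s) = a * s" "(a + b) * (b / (a + b) * s) = b * s" for s
          using pos by auto
        then show ?thesis using pos by (subst distrib_left) simp
      qed
      finally have "cmod (f x + g x) powr p
          \<le> ((a + b) * (a / (a + b) * (cmod (f x) / a) + b / (a + b) * (cmod (g x) / b))) powr p"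
        using p by (intro powr_mono2) auto
      also have "\<dots> = (a + b) powr p * (a / (a + b) * (cmod (f x) / a) + b / (a + b) * (cmod (g x) / b)) powr p"
        by (rule powr_mult)
      also have "\<dots> \<le> (a + b) powr p * (a / (a + b) * (cmod (f x) / a) powr p + b / (a + b) * (cmod (g x) / b) powr p)"
        using pos p by (intro mult_left_mono powr_convex_combination) (auto simp: add_divide_distrib[symmetric])
      also have "\<dots> = (a + b) powr p * (a / (a + b) / ?F * cmod (f x) powr p + b / (a + b) / ?G * cmod (g x) powr p)"
        by (simp add: powr_divide ap bp)
      finally show ?thesis .
    qed
    have FG: "?F \<noteq> 0" "?G \<noteq> 0" using pos ap bp by (metis powr_eq_0_iff less_irrefl)+
    have "(\<Sum>\<^sub>\<infinity>x\<in>A. cmod (f x + g x) powr p)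
        \<le> (\<Sum>\<^sub>\<infinity>x\<in>A. (a + b) powr p * (a / (a + b) / ?F * cmod (f x) powr p + b / (a + b) / ?G * cmod (g x) powr p))"
      using p f g le by (intro infsum_mono summable_on_powr_add summable_on_cmult_right summable_on_add) auto
    also have "\<dots> = (a + b) powr p * (a / (a + b) / ?F * ?F + b / (a + b) / ?G * ?G)"
      using f g by (intro infsumI has_sum_cmult_right has_sum_add has_sum_infsum)
    also have "\<dots> = (a + b) powr p"
      using FG pos by (simp add: add_divide_distrib[symmetric])
    finally have "(\<Sum>\<^sub>\<infinity>x\<in>A. cmod (f x + g x) powr p) powr (1 / p) \<le> ((a + b) powr p) powr (1 / p)"
      using p by (intro powr_mono2) (auto simp: infsum_nonneg)
    also have "\<dots> = a + b" using p pos by (simp add: powr_powr)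
    finally show ?thesis unfolding a_def b_def .
  qed
qed

lemma Hoelder_infsum:
  fixes f g :: "'a \<Rightarrow> complex"
  assumes p: "p > 1" and q: "q = p / (p - 1)" and f: "(\<lambda>x. cmod (f x) powr p) summable_on A"
    and g: "(\<lambda>x. cmod (g x) powr q) summable_on A"
  shows "(\<lambda>x. norm (f x * g x)) summable_on A"
    and "cmod (\<Sum>\<^sub>\<infinity>x\<in>A. f x * g x)
      \<le> (\<Sum>\<^sub>\<infinity>x\<in>A. cmod (f x) powr p) powr (1 / p) * (\<Sum>\<^sub>\<infinity>x\<in>A. cmod (g x) powr q) powr (1 / q)"
proof -
  let ?F = "\<Sum>\<^sub>\<infinity>x\<in>A. cmod (f x) powr p" and ?G = "\<Sum>\<^sub>\<infinity>x\<in>A. cmod (g x) powr q"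
  have q1: "q > 1" and pq: "1 / p + 1 / q = 1"
    using p by (auto simp: q field_simps)
  define a b where "a = ?F powr (1 / p)" and "b = ?G powr (1 / q)"
  have F0: "?F \<ge> 0" and G0: "?G \<ge> 0" by (simp_all add: infsum_nonneg)
  have ap: "a powr p = ?F" and bp: "b powr q = ?G"
    using F0 G0 p q1 by (simp_all add: a_def b_def powr_powr)
  show sm: "(\<lambda>x. norm (f x * g x)) summable_on A"
  proof (rule summable_on_comparison_test)
    show "(\<lambda>x. 1 / p * cmod (f x) powr p + 1 / q * cmod (g x) powr q) summable_on A"
      using f g by (intro summable_on_add summable_on_cmult_right)
    show "norm (f x * g x) \<le> 1 / p * cmod (f x) powr p + 1 / q * cmod (g x) powr q" for x
      using Youngs_inequality[OF p q1 pq, of "cmod (f x)" "cmod (g x)"] by (simp add: norm_mult)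
  qed auto
  have "cmod (\<Sum>\<^sub>\<infinity>x\<in>A. f x * g x) \<le> (\<Sum>\<^sub>\<infinity>x\<in>A. cmod (f x * g x))"
    using sm by (rule norm_infsum_bound)
  also have "\<dots> \<le> a * b"
  proof (cases "a = 0 \<or> b = 0")
    case True
    have "f x * g x = 0" if "x \<in> A" for x
    proof (cases "a = 0")
      case True
      then have "?F \<le> 0" using ap by simp
      then show ?thesis using nonneg_infsum_le_0D[OF _ f, of x] that by simp
    next
      case False
      with True have "?G \<le> 0" using bp by auto
      then show ?thesis using nonneg_infsum_le_0D[OF _ g, of x] that by simp
    qed
    then have "(\<Sum>\<^sub>\<infinity>x\<in>A. cmod (f x * g x)) = (\<Sum>\<^sub>\<infinity>x\<in>A. 0)"
      by (intro infsum_cong) auto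
    with True show ?thesis by auto
  next
    case False
    then have pos: "a > 0" "b > 0" by (auto simp: a_def b_def)
    have FG: "?F \<noteq> 0" "?G \<noteq> 0" using pos ap bp by (metis powr_eq_0_iff less_irrefl)+
    \<comment> \<open>Young's inequality for f / a and g / b; after summation the bracket becomes
      1/p + 1/q = 1.\<close>
    have le: "cmod (f x * g x) \<le> a * b * (1 / p / ?F * cmod (f x) powr p + 1 / q / ?G * cmod (g x) powr q)" for x
    proof -
      have "cmod (f x * g x) = a * b * ((cmod (f x) / a) * (cmod (g x) / b))"
        using pos by (simp add: norm_mult)
      also have "\<dots> \<le> a * b * ((cmod (f x) / a) powr p / p + (cmod (g x) / b) powr q / q)"
        using pos by (intro mult_left_mono Youngs_inequality[OF p q1 pq]) auto
      finally show ?thesis by (simp add: powr_divide ap bp mult.commute)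
    qed
    have "(\<Sum>\<^sub>\<infinity>x\<in>A. cmod (f x * g x))
        \<le> (\<Sum>\<^sub>\<infinity>x\<in>A. a * b * (1 / p / ?F * cmod (f x) powr p + 1 / q / ?G * cmod (g x) powr q))"
      using f g le sm by (intro infsum_mono summable_on_cmult_right summable_on_add) auto
    also have "\<dots> = a * b * (1 / p / ?F * ?F + 1 / q / ?G * ?G)"
      using f g by (intro infsumI has_sum_cmult_right has_sum_add has_sum_infsum)
    also have "\<dots> = a * b" using FG pq by simp
    finally show ?thesis .
  qed
  finally show "cmod (\<Sum>\<^sub>\<infinity>x\<in>A. f x * g x) \<le> ?F powr (1 / p) * ?G powr (1 / q)"
    unfolding a_def b_def .
qed

section \<open>Pointwise limits, differentiation and duality for p-th powers\<close>

lemma Fatou_powr: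
  fixes f :: "'a \<Rightarrow> complex"
  assumes lim: "\<And>x. x \<in> A \<Longrightarrow> (\<lambda>n. u n x) \<longlonglongrightarrow> f x" and p: "p > 0"
    and sm: "\<And>n. n \<ge> N \<Longrightarrow> (\<lambda>x. cmod (u n x) powr p) summable_on A"
    and le: "\<And>n. n \<ge> N \<Longrightarrow> (\<Sum>\<^sub>\<infinity>x\<in>A. cmod (u n x) powr p) \<le> b"
  shows "(\<lambda>x. cmod (f x) powr p) summable_on A" "(\<Sum>\<^sub>\<infinity>x\<in>A. cmod (f x) powr p) \<le> b"
proof -
  have "(\<Sum>x\<in>F. cmod (f x) powr p) \<le> b" if F: "finite F" "F \<subseteq> A" for F
  proof (rule LIMSEQ_le_const2)
    show "(\<lambda>n. \<Sum>x\<in>F. cmod (u n x) powr p) \<longlonglongrightarrow> (\<Sum>x\<in>F. cmod (f x) powr p)"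
      using F p lim by (intro tendsto_sum tendsto_powr' tendsto_norm tendsto_const) auto
    have "(\<Sum>x\<in>F. cmod (u n x) powr p) \<le> b" if "n \<ge> N" for n
      using finite_sum_le_infsum[OF sm[OF that] F] le[OF that] by simp
    then show "\<exists>N. \<forall>n\<ge>N. (\<Sum>x\<in>F. cmod (u n x) powr p) \<le> b" by blast
  qed
  then show "(\<lambda>x. cmod (f x) powr p) summable_on A" "(\<Sum>\<^sub>\<infinity>x\<in>A. cmod (f x) powr p) \<le> b"
    using nonneg_finite_sums_bounded[of A "\<lambda>x. cmod (f x) powr p" b] by auto
qed

text \<open>Away from \<open>a = 0\<close> the function is a power of the squared modulus, which is
  a polynomial in t, positive near 0. At \<open>a = 0\<close> the difference quotient has modulus
  |t|^(p-1) |b|^p and tends to 0 because p > 1, in agreement with the formula, which then gives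
  0.\<close>

lemma has_real_derivative_cmod_powr:
  assumes p: "p > 1"
  shows "((\<lambda>t::real. cmod (a + of_real t * b) powr p) has_real_derivative
           p * cmod a powr (p - 2) * Re (cnj a * b)) (at 0)"
proof (cases "a = 0")
  case True
  have "((\<lambda>t::real. (\<bar>t\<bar> powr p * cmod b powr p - 0) / t) \<longlongrightarrow> 0) (at 0)"
  proof (rule tendsto_norm_zero_cancel)
    have "((\<lambda>t::real. \<bar>t\<bar> powr (p - 1) * cmod b powr p) \<longlongrightarrow> \<bar>0\<bar> powr (p - 1) * cmod b powr p) (at 0)"
      using p by (intro tendsto_mult tendsto_powr' tendsto_rabs tendsto_ident_at tendsto_const) auto
    moreover have "\<forall>\<^sub>F t::real in at 0. \<bar>t\<bar> powr (p - 1) * cmod b powr p = norm ((\<bar>t\<bar> powr p * cmod b powr p - 0) / t)"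
      unfolding eventually_at_filter
      by (intro always_eventually) (auto simp: abs_mult powr_diff)
    ultimately show "((\<lambda>t::real. norm ((\<bar>t\<bar> powr p * cmod b powr p - 0) / t)) \<longlongrightarrow> 0) (at 0)"
      using p by (auto intro: Lim_transform_eventually)
  qed
  then show ?thesis
    using True p by (simp add: has_field_derivative_iff norm_mult powr_mult)
next
  case False
  have "((\<lambda>t::real. (cmod (a + of_real t * b))\<^sup>2 powr (p / 2)) has_real_derivative
      p / 2 * ((cmod a)\<^sup>2) powr (p / 2 - 1) * (2 * Re (cnj a * b))) (at 0)"
  proof -
    have eq: "(cmod (a + of_real t * b))\<^sup>2 = (Re a + t * Re b)\<^sup>2 + (Im a + t * Im b)\<^sup>2" for t
      by (simp add: cmod_power2)
    have "((\<lambda>t::real. ((Re a + t * Re b)\<^sup>2 + (Im a + t * Im b)\<^sup>2) powr (p / 2)) has_real_derivative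
      p / 2 * ((Re a)\<^sup>2 + (Im a)\<^sup>2) powr (p / 2 - 1) * (2 * Re (cnj a * b))) (at 0)"
      using False by (auto intro!: derivative_eq_intros simp: complex_eq_iff sum_power2_gt_zero_iff algebra_simps)
    then show ?thesis unfolding eq by (simp add: cmod_power2)
  qed
  moreover have sq: "r\<^sup>2 powr s = r powr (2 * s)" if "r \<ge> 0" for r s :: real
    using that by (cases "r = 0") (simp_all add: powr_powr flip: powr_numeral)
  moreover have "p / 2 * ((cmod a)\<^sup>2) powr (p / 2 - 1) * (2 * Re (cnj a * b)) = p * cmod a powr (p - 2) * Re (cnj a * b)"
    using sq[of "cmod a" "p / 2 - 1"] by (simp add: right_diff_distrib del: times_complex.sel)
  ultimately show ?thesis
    by (simp add: mult.assoc del: times_complex.sel)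
qed

text \<open>The converse of Hoelder's inequality. Testing on finite sets only means that summability
  of |v|^q need not be known in advance.\<close>

lemma powr_dual_bound:
  fixes v :: "'a \<Rightarrow> complex"
  assumes p: "p > 1" and q: "q = p / (p - 1)" and M: "M \<ge> 0"
    and bound: "\<And>F u. finite F \<Longrightarrow> F \<subseteq> A \<Longrightarrow>
      Re (\<Sum>x\<in>F. cnj (v x) * u x) \<le> M * (\<Sum>x\<in>F. cmod (u x) powr p) powr (1 / p)"
  shows "(\<Sum>\<^sub>\<infinity>x\<in>A. cmod (v x) powr q) powr (1 / q) \<le> M"
proof -
  have q1: "q > 1" and qp: "(q - 1) * p = q" and pq: "1 - 1 / p = 1 / q"
    using p by (auto simp: q field_simps)
  have "(\<Sum>x\<in>F. cmod (v x) powr q) \<le> M powr q" if F: "finite F" "F \<subseteq> A" for F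
  proof -
    let ?S = "\<Sum>x\<in>F. cmod (v x) powr q"
    have S0: "?S \<ge> 0" by (simp add: sum_nonneg)
    \<comment> \<open>The equality case of Hoelder's inequality: both |u|^p and
      \<open>cnj v * u\<close> equal |v|^q, so the hypothesis reads S \<le> M S^(1/p), which is
      solved for S.\<close>
    define u where "u x = of_real (cmod (v x) powr (q - 2)) * v x" for x
    have [simp]: "cmod (u x) = cmod (v x) powr (q - 1)" for x
    proof (cases "v x = 0")
      case False
      then have "cmod (v x) powr (q - 1) = cmod (v x) powr (q - 2) * cmod (v x) powr 1"
        by (subst powr_add[symmetric]) simp
      then show ?thesis
        by (simp add: u_def norm_mult)
    qed (simp add: u_def)
    have "cnj (v x) * u x = of_real (cmod (v x) powr q)" for x
    proof (cases "v x = 0")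
      case False
      have "cnj (v x) * u x = of_real (cmod (v x) powr (q - 2)) * (v x * cnj (v x))"
        by (simp add: u_def)
      also have "\<dots> = of_real (cmod (v x) powr (q - 2) * (cmod (v x))\<^sup>2)"
        by (simp add: complex_norm_square[symmetric])
      also have "cmod (v x) powr (q - 2) * (cmod (v x))\<^sup>2 = cmod (v x) powr q"
        using False by (simp add: powr_diff powr_numeral)
      finally show ?thesis .
    qed (simp add: u_def)
    then have "?S \<le> M * ?S powr (1 / p)"
      using bound[OF F, of u] by (simp add: powr_powr qp)
    show ?thesis
    proof (cases "?S = 0")
      case False
      with S0 have pos: "?S > 0" by simp
      have "?S powr (1 / q) = ?S / ?S powr (1 / p)"
        using pos pq[symmetric] by (simp add: powr_diff)
      also have "\<dots> \<le> M"
        using \<open>?S \<le> M * ?S powr (1 / p)\<close> pos by (simp add: divide_le_eq)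
      finally have "(?S powr (1 / q)) powr q \<le> M powr q"
        using q1 by (intro powr_mono2) auto
      then show ?thesis using pos q1 by (simp add: powr_powr)
    qed simp
  qed
  then have "(\<Sum>\<^sub>\<infinity>x\<in>A. cmod (v x) powr q) \<le> M powr q"
    by (intro nonneg_finite_sums_bounded) auto
  then have "(\<Sum>\<^sub>\<infinity>x\<in>A. cmod (v x) powr q) powr (1 / q) \<le> (M powr q) powr (1 / q)"
    using q1 by (intro powr_mono2) (auto simp: infsum_nonneg)
  then show ?thesis using q1 M by (simp add: powr_powr)
qed

section \<open>Ekeland's variational principle\<close>

text \<open>Call y below x if \<open>y \<in> S x\<close>; the triangle inequality makes this
  relation transitive. A descending sequence of almost optimal choices is Cauchy, and its limit has
  nothing but itself below it. The assumption \<open>lsc\<close> is lower semicontinuity in the form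
  that sublevel sets are sequentially closed.\<close>

lemma (in Metric_space) Ekeland:
  fixes \<phi> :: "'a \<Rightarrow> real"
  assumes complete: mcomplete and "M \<noteq> {}" and "\<epsilon> > 0"
    and \<phi>_nonneg: "\<And>x. x \<in> M \<Longrightarrow> \<phi> x \<ge> 0"
    and lsc: "\<And>\<sigma> x b. limitin mtopology \<sigma> x sequentially \<Longrightarrow> range \<sigma> \<subseteq> M \<Longrightarrow>
      (\<And>n. \<phi> (\<sigma> n) \<le> b) \<Longrightarrow> \<phi> x \<le> b"
  obtains x where "x \<in> M" "\<And>y. y \<in> M \<Longrightarrow> \<phi> y + \<epsilon> * d x y \<le> \<phi> x \<Longrightarrow> y = x"
proof -
  define S where "S x = {y \<in> M. \<phi> y + \<epsilon> * d x y \<le> \<phi> x}" for x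
  have S_refl: "x \<in> S x" if "x \<in> M" for x using that by (simp add: S_def)
  have S_trans: "z \<in> S x" if "x \<in> M" "y \<in> S x" "z \<in> S y" for x y z
  proof -
    have "\<epsilon> * d x z \<le> \<epsilon> * (d x y + d y z)"
      using that \<open>\<epsilon> > 0\<close> by (intro mult_left_mono triangle) (auto simp: S_def)
    then show ?thesis using that by (auto simp: S_def distrib_left)
  qed
  have bdd: "bdd_below (\<phi> ` S x)" for x
    by (rule bdd_belowI2[where m = 0]) (auto simp: S_def \<phi>_nonneg)
  have step: "\<exists>y. y \<in> M \<and> (y \<in> S x \<and> (\<forall>z\<in>S x. \<phi> y \<le> \<phi> z + (1 / 2) ^ n))" if "x \<in> M" for x and n :: nat
  proof -
    have "Inf (\<phi> ` S x) < Inf (\<phi> ` S x) + (1 / 2) ^ n" by simp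
    moreover have "\<phi> ` S x \<noteq> {}" using S_refl[OF \<open>x \<in> M\<close>] by auto
    ultimately obtain y where y: "y \<in> S x" "\<phi> y < Inf (\<phi> ` S x) + (1 / 2) ^ n"
      using cInf_lessD[of "\<phi> ` S x"] by blast
    have "\<phi> y \<le> \<phi> z + (1 / 2) ^ n" if "z \<in> S x" for z
    proof -
      have "Inf (\<phi> ` S x) \<le> \<phi> z"
        using that bdd by (intro cInf_lower) auto
      then show ?thesis using y by simp
    qed
    then show ?thesis using y(1) by (auto simp: S_def)
  qed
  obtain \<sigma> where \<sigma>M: "\<And>n. \<sigma> n \<in> M" and \<sigma>S: "\<And>n. \<sigma> (Suc n) \<in> S (\<sigma> n)"
    and \<sigma>min: "\<And>n z. z \<in> S (\<sigma> n) \<Longrightarrow> \<phi> (\<sigma> (Suc n)) \<le> \<phi> z + (1 / 2) ^ n"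
    using dependent_nat_choice[of "\<lambda>n x. x \<in> M" "\<lambda>n x y. y \<in> S x \<and> (\<forall>z\<in>S x. \<phi> y \<le> \<phi> z + (1 / 2) ^ n)"]
      \<open>M \<noteq> {}\<close> step by blast
  have chain: "\<sigma> (n + k) \<in> S (\<sigma> n)" for n k
    by (induction k) (use \<sigma>M \<sigma>S S_refl S_trans in auto)
  have dist: "\<epsilon> * d (\<sigma> m) (\<sigma> n) \<le> \<phi> (\<sigma> m) - \<phi> (\<sigma> n)" if "m \<le> n" for m n
    using chain[of m "n - m"] that by (simp add: S_def)
  have dec: "\<phi> (\<sigma> n) \<le> \<phi> (\<sigma> m)" if "m \<le> n" for m n
    using dist[OF that] mult_nonneg_nonneg[OF less_imp_le[OF \<open>\<epsilon> > 0\<close>] nonneg[of "\<sigma> m" "\<sigma> n"]] by linarith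
  \<comment> \<open>Almost optimality of \<sigma> (Suc N) bounds every later decrease of \<phi>, and
    these decreases control the distances.\<close>
  have gap: "\<epsilon> * d (\<sigma> m) (\<sigma> n) \<le> (1 / 2) ^ N" if "Suc N \<le> m" "m \<le> n" for m n N
  proof -
    have "\<phi> (\<sigma> (Suc N)) \<le> \<phi> (\<sigma> n) + (1 / 2) ^ N"
      using chain[of N "n - N"] that by (intro \<sigma>min) simp
    then show ?thesis using dist[OF that(2)] dec[OF that(1)] by linarith
  qed
  have "MCauchy \<sigma>"
    unfolding MCauchy_def
  proof (intro conjI allI impI)
    show "range \<sigma> \<subseteq> M" using \<sigma>M by auto
    fix e :: real assume "e > 0"
    then obtain N where N: "(1 / 2) ^ N < \<epsilon> * e"
      using real_arch_pow_inv[of "\<epsilon> * e" "1 / 2"] \<open>\<epsilon> > 0\<close> by auto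
    have "d (\<sigma> m) (\<sigma> n) < e" if "Suc N \<le> m" "m \<le> n" for m n
    proof -
      have "\<epsilon> * d (\<sigma> m) (\<sigma> n) < \<epsilon> * e" using gap[OF that] N by linarith
      then show ?thesis using \<open>\<epsilon> > 0\<close> by simp
    qed
    then have "d (\<sigma> m) (\<sigma> n) < e" if "Suc N \<le> m" "Suc N \<le> n" for m n
      using that commute by (metis nle_le)
    then show "\<exists>N. \<forall>m n. N \<le> m \<longrightarrow> N \<le> n \<longrightarrow> d (\<sigma> m) (\<sigma> n) < e" by blast
  qed
  then obtain x where x: "limitin mtopology \<sigma> x sequentially"
    using complete by (auto simp: mcomplete_def)
  then have xM: "x \<in> M" by (simp add: limit_metric_sequentially)
  have xS: "x \<in> S (\<sigma> n)" for n
  proof -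
    have "\<phi> x + \<epsilon> * d (\<sigma> n) x \<le> \<phi> (\<sigma> n) + e" if "e > 0" for e
    proof -
      obtain N where N: "\<And>k. k \<ge> N \<Longrightarrow> d (\<sigma> k) x < e / \<epsilon>"
        using x divide_pos_pos[OF \<open>e > 0\<close> \<open>\<epsilon> > 0\<close>] unfolding limit_metric_sequentially by blast
      \<comment> \<open>The distance term is moved into the constant bound, so that
        \<open>lsc\<close> applies to \<phi> alone; the slack e absorbs the distance from \<sigma> k
        to x for large k.\<close>
      have "\<phi> x \<le> \<phi> (\<sigma> n) + e - \<epsilon> * d (\<sigma> n) x"
      proof (rule lsc)
        show "limitin mtopology (\<lambda>k. \<sigma> (k + (N + n))) x sequentially"
          using x by (rule limitin_sequentially_offset)
        show "\<phi> (\<sigma> (k + (N + n))) \<le> \<phi> (\<sigma> n) + e - \<epsilon> * d (\<sigma> n) x" for k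
        proof -
          let ?k = "k + (N + n)"
          have "\<epsilon> * d (\<sigma> n) x \<le> \<epsilon> * (d (\<sigma> n) (\<sigma> ?k) + d (\<sigma> ?k) x)"
            using \<sigma>M xM \<open>\<epsilon> > 0\<close> by (intro mult_left_mono triangle) auto
          moreover have "\<epsilon> * d (\<sigma> ?k) x \<le> e"
            using N[of ?k] \<open>\<epsilon> > 0\<close> by (simp add: pos_less_divide_eq mult.commute)
          ultimately show ?thesis using dist[of n ?k] by (simp add: distrib_left)
        qed
      qed (use \<sigma>M in auto)
      then show ?thesis by simp
    qed
    then show ?thesis using xM by (simp add: S_def field_le_epsilon)
  qed
  show thesis
  proof (rule that[OF xM])
    fix y assume y: "y \<in> M" "\<phi> y + \<epsilon> * d x y \<le> \<phi> x"
    \<comment> \<open>By transitivity y is below every \<sigma> n, so almost optimality of \<sigma>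
      (Suc n) leaves at most (1/2)^n for the drop from \<phi> x to \<phi> y.\<close>
    have "\<epsilon> * d x y \<le> e" if "e > 0" for e
    proof -
      obtain n where n: "(1 / 2) ^ n < e"
        using real_arch_pow_inv[of e "1 / 2"] \<open>e > 0\<close> by auto
      have "y \<in> S x" using y by (simp add: S_def)
      then have "y \<in> S (\<sigma> n)" by (rule S_trans[OF \<sigma>M xS])
      from \<sigma>min[OF this] have "\<phi> (\<sigma> (Suc n)) \<le> \<phi> y + (1 / 2) ^ n" .
      moreover have "\<phi> x + \<epsilon> * d (\<sigma> (Suc n)) x \<le> \<phi> (\<sigma> (Suc n))"
        using xS[of "Suc n"] by (simp add: S_def)
      moreover have "0 \<le> \<epsilon> * d (\<sigma> (Suc n)) x"
        using \<open>\<epsilon> > 0\<close> by simp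
      ultimately show ?thesis using y n by linarith
    qed
    then have "\<epsilon> * d x y \<le> 0" by (rule field_le_epsilon[of _ 0, simplified])
    then have "d x y \<le> 0" using \<open>\<epsilon> > 0\<close> by (simp add: mult_le_0_iff)
    then have "d x y = 0" using nonneg[of x y] by linarith
    then show "y = x" using zero[OF xM y(1)] by simp
  qed
qed

section \<open>Translations in groups\<close>

lemma (in group) bij_betw_mult_left:
  assumes "a \<in> carrier G" shows "bij_betw (\<lambda>x. a \<otimes> x) (carrier G) (carrier G)"
  by (rule bij_betw_byWitness[where f' = "\<lambda>x. inv a \<otimes> x"]) (use assms in \<open>auto simp: m_assoc[symmetric]\<close>)

lemma (in group) bij_betw_mult_right:
  assumes "a \<in> carrier G" shows "bij_betw (\<lambda>x. x \<otimes> a) (carrier G) (carrier G)"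
  by (rule bij_betw_byWitness[where f' = "\<lambda>x. x \<otimes> inv a"]) (use assms in \<open>auto simp: m_assoc\<close>)

lemma (in group) translate_avoid:
  assumes "infinite (carrier G)" "finite T" "T \<subseteq> carrier G" "finite U" "U \<subseteq> carrier G"
  obtains g where "g \<in> carrier G" "(\<lambda>t. t \<otimes> g) ` T \<inter> U = {}"
proof -
  \<comment> \<open>The forbidden translations: t g = y forces g = t^-1 y, so only finitely many g
    bring T into contact with U.\<close>
  have "finite ((\<lambda>(t, y). inv t \<otimes> y) ` (T \<times> U))" using assms by blast
  then obtain g where g: "g \<in> carrier G" "g \<notin> (\<lambda>(t, y). inv t \<otimes> y) ` (T \<times> U)"
    using assms(1) by (metis finite_subset subsetI)
  have "t \<otimes> g \<notin> U" if t: "t \<in> T" for t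
  proof
    assume "t \<otimes> g \<in> U"
    moreover have "g = inv t \<otimes> (t \<otimes> g)" using t g(1) assms(3) by (auto simp: m_assoc[symmetric])
    ultimately show False using g(2) t by force
  qed
  with g(1) show thesis by (intro that) auto
qed

section \<open>The p-energy\<close>

locale dirichlet_setting = group G
  for G :: "('a, 'b) monoid_scheme" (structure) +
  fixes K :: "'a set" and m :: "'a \<Rightarrow> real" and p q :: real
  assumes infinite_G: "infinite (carrier G)"
    and finite_K: "finite K"
    and K_sub: "K \<subseteq> carrier G"
    and K_gen: "generate G K = carrier G"
    and inv_K: "(\<lambda>\<gamma>. inv \<gamma>) ` K = K"
    and weight: "symmetric_weight G K m"
    and p: "1 < p" and q: "q = p / (p - 1)"
begin

lemma m_pos: "\<gamma> \<in> K \<Longrightarrow> m \<gamma> > 0"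
  and m_sum: "(\<Sum>\<gamma>\<in>K. m \<gamma>) = 1"
  and m_inv: "\<gamma> \<in> K \<Longrightarrow> m (inv \<gamma>) = m \<gamma>"
  using weight by (auto simp: symmetric_weight_def)

lemma K_carrier: "\<gamma> \<in> K \<Longrightarrow> \<gamma> \<in> carrier G"
  using K_sub by auto

lemma inv_in_K: "\<gamma> \<in> K \<Longrightarrow> inv \<gamma> \<in> K"
  using inv_K by auto

lemma bij_inv_K: "bij_betw (\<lambda>\<gamma>. inv \<gamma>) K K"
  by (rule bij_betw_byWitness[where f' = "\<lambda>\<gamma>. inv \<gamma>"]) (auto simp: K_carrier inv_in_K)

lemma q_gt_1: "q > 1" and q_mult: "(p - 1) * q = p"
  using p by (auto simp: q field_simps)

abbreviation lp :: "('a \<Rightarrow> complex) \<Rightarrow> bool"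
  where "lp f \<equiv> (\<lambda>x. cmod (f x) powr p) summable_on carrier G"

definition psum :: "('a \<Rightarrow> complex) \<Rightarrow> real"
  where "psum f = (\<Sum>\<^sub>\<infinity>x\<in>carrier G. cmod (f x) powr p)"

text \<open>Not restricted to the carrier, unlike \<open>diff_fun\<close>, so that linearity in f
  holds as an identity without membership conditions. The congruence lemmas below transfer results
  to extensional functions.\<close>

definition D :: "('a \<Rightarrow> complex) \<Rightarrow> 'a \<Rightarrow> 'a \<Rightarrow> complex"
  where "D f \<gamma> x = f (inv \<gamma> \<otimes> x) - f x"

definition in_D :: "('a \<Rightarrow> complex) \<Rightarrow> bool"
  where "in_D f \<longleftrightarrow> (\<forall>\<gamma>\<in>K. lp (D f \<gamma>))"

text \<open>Summing over K first gives a local density on the group: a change of f on a finite set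
  affects it at finitely many points only.\<close>

definition edens :: "('a \<Rightarrow> complex) \<Rightarrow> 'a \<Rightarrow> real"
  where "edens f x = (\<Sum>\<gamma>\<in>K. m \<gamma> * cmod (D f \<gamma> x) powr p)"

definition energy :: "('a \<Rightarrow> complex) \<Rightarrow> real"
  where "energy f = (\<Sum>\<^sub>\<infinity>x\<in>carrier G. edens f x)"

text \<open>The gradient under the duality map z |-> |z|^(p-2) z from l^p to l^q: the modulus to the
  power q is |D f|^p, and so is the pairing of the flux with D f.\<close>

definition flux :: "('a \<Rightarrow> complex) \<Rightarrow> 'a \<Rightarrow> 'a \<Rightarrow> complex"
  where "flux f \<gamma> x = of_real (cmod (D f \<gamma> x) powr (p - 2)) * D f \<gamma> x"

definition lap :: "('a \<Rightarrow> complex) \<Rightarrow> 'a \<Rightarrow> complex"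
  where "lap f x = (\<Sum>\<gamma>\<in>K. flux f \<gamma> x * of_real (m \<gamma>))"

lemma ell_iff: "f \<in> ell G p \<longleftrightarrow> f \<in> extensional (carrier G) \<and> lp f"
  by (simp add: ell_def PiE_def)

lemma lp_cong: "(\<And>x. x \<in> carrier G \<Longrightarrow> f x = g x) \<Longrightarrow> lp f \<longleftrightarrow> lp g"
  by (intro summable_on_cong) simp

lemma psum_cong: "(\<And>x. x \<in> carrier G \<Longrightarrow> f x = g x) \<Longrightarrow> psum f = psum g"
  unfolding psum_def by (intro infsum_cong) simp

lemma psum_nonneg: "psum f \<ge> 0"
  by (simp add: psum_def infsum_nonneg)

lemma ell_norm_p: "ell_norm G p f = psum f powr (1 / p)"
  by (simp add: ell_norm_def psum_def)

lemma restrict_ell: "restrict f (carrier G) \<in> ell G p \<longleftrightarrow> lp f"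
  using lp_cong[of "restrict f (carrier G)" f] by (simp add: ell_iff)

lemma D_cong: "(\<And>x. x \<in> carrier G \<Longrightarrow> f x = g x) \<Longrightarrow> \<gamma> \<in> carrier G \<Longrightarrow> x \<in> carrier G \<Longrightarrow> D f \<gamma> x = D g \<gamma> x"
  by (simp add: D_def)

lemma edens_cong: "(\<And>x. x \<in> carrier G \<Longrightarrow> f x = g x) \<Longrightarrow> x \<in> carrier G \<Longrightarrow> edens f x = edens g x"
  unfolding edens_def using D_cong[of f g] by (intro sum.cong) (auto simp: K_carrier)

lemma energy_cong: "(\<And>x. x \<in> carrier G \<Longrightarrow> f x = g x) \<Longrightarrow> energy f = energy g"
  unfolding energy_def using edens_cong[of f g] by (intro infsum_cong) auto

lemma lap_cong: "(\<And>x. x \<in> carrier G \<Longrightarrow> f x = g x) \<Longrightarrow> x \<in> carrier G \<Longrightarrow> lap f x = lap g x"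
  unfolding lap_def flux_def using D_cong[of f g] by (intro sum.cong) (auto simp: K_carrier)

lemma in_D_cong: "(\<And>x. x \<in> carrier G \<Longrightarrow> f x = g x) \<Longrightarrow> in_D f \<longleftrightarrow> in_D g"
  unfolding in_D_def using D_cong[of f g] by (intro ball_cong lp_cong) (auto simp: K_carrier)

lemma diff_fun_eq: "diff_fun G f \<gamma> = restrict (D f \<gamma>) (carrier G)"
  by (auto simp: diff_fun_def left_reg_def D_def)

lemma dirichlet_space_iff: "f \<in> dirichlet_space G K p \<longleftrightarrow> f \<in> extensional (carrier G) \<and> in_D f"
  by (simp add: dirichlet_space_def PiE_def diff_fun_eq restrict_ell in_D_def)

lemma p_laplacian_eq: "x \<in> carrier G \<Longrightarrow> p_laplacian G K m p f x = lap f x"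
  by (simp add: p_laplacian_def lap_def flux_def diff_fun_eq)

lemma edens_nonneg: "edens f x \<ge> 0"
  unfolding edens_def using m_pos by (intro sum_nonneg) (simp add: less_imp_le)

lemma energy_nonneg: "energy f \<ge> 0"
  by (simp add: energy_def infsum_nonneg edens_nonneg)

lemma has_sum_energy:
  assumes "in_D f"
  shows "(edens f has_sum (\<Sum>\<gamma>\<in>K. m \<gamma> * psum (D f \<gamma>))) (carrier G)"
  unfolding edens_def[abs_def] psum_def
  using assms by (intro has_sum_sum has_sum_cmult_right has_sum_infsum) (simp add: in_D_def)

lemma energy_eq: "in_D f \<Longrightarrow> energy f = (\<Sum>\<gamma>\<in>K. m \<gamma> * psum (D f \<gamma>))"
  unfolding energy_def using has_sum_energy by (rule infsumI)

lemma summable_edens: "in_D f \<Longrightarrow> edens f summable_on carrier G"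
  using has_sum_energy has_sum_imp_summable by blast

lemma dirichlet_norm_eq:
  assumes "in_D f" shows "dirichlet_norm G K m p f = energy f powr (1 / p)"
proof -
  have "psum (restrict (D f \<gamma>) (carrier G)) = psum (D f \<gamma>)" for \<gamma>
    by (rule psum_cong) simp
  then show ?thesis
    using p by (simp add: dirichlet_norm_def ell_norm_p energy_eq[OF assms] diff_fun_eq powr_powr psum_nonneg mult.commute)
qed

section \<open>Translation invariance, comparison of energy and p-norm, and the null space of the
  energy\<close>

lemma psum_translate:
  assumes "\<gamma> \<in> carrier G"
  shows "lp (\<lambda>x. f (\<gamma> \<otimes> x)) \<longleftrightarrow> lp f" "psum (\<lambda>x. f (\<gamma> \<otimes> x)) = psum f"
  unfolding psum_def
  using summable_on_reindex_bij_betw[OF bij_betw_mult_left[OF assms], of "\<lambda>x. cmod (f x) powr p"]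
    infsum_reindex_bij_betw[OF bij_betw_mult_left[OF assms], of "\<lambda>x. cmod (f x) powr p"]
  by simp_all

lemma psum_translate_right:
  assumes "a \<in> carrier G"
  shows "psum (\<lambda>x. f (x \<otimes> a)) = psum f"
  unfolding psum_def
  using infsum_reindex_bij_betw[OF bij_betw_mult_right[OF assms], of "\<lambda>x. cmod (f x) powr p"]
  by simp

text \<open>Right translations commute with the left translations in \<open>D\<close>. This is why
  bumps will be moved apart by right translations.\<close>

lemma energy_translate_right:
  assumes a: "a \<in> carrier G"
  shows "energy (\<lambda>x. f (x \<otimes> a)) = energy f"
proof -
  have "D (\<lambda>x. f (x \<otimes> a)) \<gamma> x = D f \<gamma> (x \<otimes> a)" if "\<gamma> \<in> carrier G" "x \<in> carrier G" for \<gamma> x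
    using that a by (simp add: D_def m_assoc)
  then have "edens (\<lambda>x. f (x \<otimes> a)) x = edens f (x \<otimes> a)" if "x \<in> carrier G" for x
    using that unfolding edens_def by (intro sum.cong) (auto simp: K_carrier)
  then have "energy (\<lambda>x. f (x \<otimes> a)) = (\<Sum>\<^sub>\<infinity>x\<in>carrier G. edens f (x \<otimes> a))"
    unfolding energy_def by (intro infsum_cong) auto
  also have "\<dots> = energy f"
    unfolding energy_def by (rule infsum_reindex_bij_betw[OF bij_betw_mult_right[OF a]])
  finally show ?thesis .
qed

lemma lp_D: "lp f \<Longrightarrow> \<gamma> \<in> carrier G \<Longrightarrow> lp (D f \<gamma>)"
  unfolding D_def using p psum_translate(1)[of "inv \<gamma>" f] by (intro summable_on_powr_diff) auto

lemma in_D_lp: "lp f \<Longrightarrow> in_D f"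
  by (simp add: in_D_def lp_D K_carrier)

lemma in_D_add:
  assumes "in_D f" "in_D g"
  shows "in_D (\<lambda>x. f x + g x)"
proof -
  have "D (\<lambda>x. f x + g x) \<gamma> x = D f \<gamma> x + D g \<gamma> x" for \<gamma> x by (simp add: D_def)
  then show ?thesis
    using assms p by (simp add: in_D_def summable_on_powr_add)
qed

lemma energy_add_le:
  assumes "in_D f" "in_D g"
  shows "energy (\<lambda>x. f x + g x) \<le> 2 powr p * (energy f + energy g)"
proof -
  have "edens (\<lambda>x. f x + g x) x \<le> 2 powr p * (edens f x + edens g x)" for x
  proof -
    have "edens (\<lambda>x. f x + g x) x \<le> (\<Sum>\<gamma>\<in>K. m \<gamma> * (2 powr p * (cmod (D f \<gamma> x) powr p + cmod (D g \<gamma> x) powr p)))"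
      unfolding edens_def
    proof (intro sum_mono mult_left_mono)
      fix \<gamma> assume "\<gamma> \<in> K"
      have "D (\<lambda>x. f x + g x) \<gamma> x = D f \<gamma> x + D g \<gamma> x" by (simp add: D_def)
      then show "cmod (D (\<lambda>x. f x + g x) \<gamma> x) powr p \<le> 2 powr p * (cmod (D f \<gamma> x) powr p + cmod (D g \<gamma> x) powr p)"
        using cmod_add_powr_le[of p] p by simp
    qed (simp add: m_pos less_imp_le)
    also have "\<dots> = 2 powr p * (edens f x + edens g x)"
      by (simp add: edens_def sum_distrib_left sum.distrib distrib_left mult_ac)
    finally show ?thesis .
  qed
  then have "energy (\<lambda>x. f x + g x) \<le> (\<Sum>\<^sub>\<infinity>x\<in>carrier G. 2 powr p * (edens f x + edens g x))"
    unfolding energy_def using assms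
    by (intro infsum_mono summable_edens in_D_add summable_on_cmult_right summable_on_add)
  also have "\<dots> = 2 powr p * (energy f + energy g)"
    unfolding energy_def
    using assms by (intro infsumI has_sum_cmult_right has_sum_add has_sum_infsum summable_edens)
  finally show ?thesis .
qed

lemma energy_lp_le:
  assumes f: "lp f"
  shows "energy f \<le> 2 powr p * 2 * psum f"
proof -
  have "psum (D f \<gamma>) \<le> 2 powr p * 2 * psum f" if \<gamma>: "\<gamma> \<in> K" for \<gamma>
  proof -
    have t: "lp (\<lambda>x. f (inv \<gamma> \<otimes> x))" "psum (\<lambda>x. f (inv \<gamma> \<otimes> x)) = psum f"
      using psum_translate[of "inv \<gamma>" f] f K_carrier[OF \<gamma>] by auto
    have "psum (D f \<gamma>) \<le> (\<Sum>\<^sub>\<infinity>x\<in>carrier G. 2 powr p * (cmod (f (inv \<gamma> \<otimes> x)) powr p + cmod (f x) powr p))"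
      unfolding psum_def
    proof (rule infsum_mono)
      show "lp (D f \<gamma>)" using lp_D[OF f K_carrier[OF \<gamma>]] .
      show "cmod (D f \<gamma> x) powr p \<le> 2 powr p * (cmod (f (inv \<gamma> \<otimes> x)) powr p + cmod (f x) powr p)" for x
        using cmod_add_powr_le[of p "f (inv \<gamma> \<otimes> x)" "- f x"] p by (simp add: D_def)
    qed (use t f in \<open>intro summable_on_cmult_right summable_on_add\<close>)
    also have "\<dots> = 2 powr p * (psum f + psum f)"
      using has_sum_infsum[OF t(1)] t(2) f
      by (intro infsumI has_sum_cmult_right has_sum_add) (auto simp: psum_def)
    finally show ?thesis by simp
  qed
  then have "(\<Sum>\<gamma>\<in>K. m \<gamma> * psum (D f \<gamma>)) \<le> (\<Sum>\<gamma>\<in>K. m \<gamma> * (2 powr p * 2 * psum f))"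
    by (intro sum_mono mult_left_mono) (auto simp: m_pos less_imp_le)
  also have "\<dots> = 2 powr p * 2 * psum f"
    by (simp add: sum_distrib_right[symmetric] m_sum)
  finally show ?thesis by (simp add: energy_eq[OF in_D_lp[OF f]])
qed

lemma energy_scale: "energy (\<lambda>x. of_real c * f x) = \<bar>c\<bar> powr p * energy f"
proof -
  have "D (\<lambda>x. of_real c * f x) \<gamma> x = of_real c * D f \<gamma> x" for \<gamma> x
    by (simp add: D_def right_diff_distrib)
  then have "edens (\<lambda>x. of_real c * f x) x = \<bar>c\<bar> powr p * edens f x" for x
    by (simp add: edens_def norm_mult powr_mult sum_distrib_left mult_ac)
  then show ?thesis by (simp add: energy_def infsum_cmult_right')
qed

lemma psum_scale: "psum (\<lambda>x. of_real c * f x) = \<bar>c\<bar> powr p * psum f"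
  by (simp add: psum_def norm_mult powr_mult infsum_cmult_right')

text \<open>Positive weights force every difference along K to vanish. Invariance under K propagates
  to the generated group, which is everything, and then f x is compared with f at \<one>.\<close>

lemma constant_if_energy_zero:
  assumes f: "in_D f" and "energy f = 0" and x: "x \<in> carrier G"
  shows "f x = f \<one>"
proof -
  have D0: "D f \<gamma> y = 0" if "\<gamma> \<in> K" "y \<in> carrier G" for \<gamma> y
  proof -
    have "edens f y = 0"
      using nonneg_infsum_le_0D[of "edens f" "carrier G" y] summable_edens[OF f] edens_nonneg assms(2) that
      by (simp add: energy_def)
    then have "m \<gamma> * cmod (D f \<gamma> y) powr p = 0"
      unfolding edens_def using finite_K that
      by (subst (asm) sum_nonneg_eq_0_iff) (auto simp: m_pos less_imp_le)
    then show ?thesis using m_pos[OF that(1)] by simp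
  qed
  have *: "f (inv \<gamma> \<otimes> y) = f y" if "\<gamma> \<in> K" "y \<in> carrier G" for \<gamma> y
    using D0[OF that] by (simp add: D_def)
  have "\<forall>y\<in>carrier G. f (g \<otimes> y) = f y" if "g \<in> generate G K" for g
    using that
  proof (induction rule: generate.induct)
    case (incl h)
    then show ?case using *[OF inv_in_K] K_carrier by simp
  next
    case (eng h1 h2)
    then show ?case using K_gen by (simp add: m_assoc)
  qed (use * in auto)
  then have "f (x \<otimes> \<one>) = f \<one>" using x K_gen by blast
  then show ?thesis using x by simp
qed

subsection \<open>Green's formula and the gradient of the energy\<close>

lemma norm_flux_powr: "cmod (flux f \<gamma> x) powr q = cmod (D f \<gamma> x) powr p"
proof (cases "D f \<gamma> x = 0")
  case False
  then have "cmod (flux f \<gamma> x) = cmod (D f \<gamma> x) powr (p - 2) * cmod (D f \<gamma> x) powr 1"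
    by (simp add: flux_def norm_mult)
  also have "\<dots> = cmod (D f \<gamma> x) powr (p - 1)"
    by (subst powr_add[symmetric]) simp
  finally show ?thesis using q_mult by (simp add: powr_powr)
qed (simp add: flux_def)

lemma cnj_flux_mult: "cnj (flux f \<gamma> x) * D f \<gamma> x = of_real (cmod (D f \<gamma> x) powr p)"
proof (cases "D f \<gamma> x = 0")
  case False
  have "cnj (flux f \<gamma> x) * D f \<gamma> x = of_real (cmod (D f \<gamma> x) powr (p - 2)) * (D f \<gamma> x * cnj (D f \<gamma> x))"
    by (simp add: flux_def)
  also have "\<dots> = of_real (cmod (D f \<gamma> x) powr (p - 2) * (cmod (D f \<gamma> x))\<^sup>2)"
    by (simp add: complex_norm_square[symmetric])
  also have "cmod (D f \<gamma> x) powr (p - 2) * (cmod (D f \<gamma> x))\<^sup>2 = cmod (D f \<gamma> x) powr p"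
    using False by (simp add: powr_diff powr_numeral)
  finally show ?thesis .
qed (simp add: flux_def)

text \<open>Both sides concern the edge between x and \<gamma> x of the Cayley graph, traversed in
  opposite directions.\<close>

lemma flux_antisymmetric:
  assumes "\<gamma> \<in> carrier G" "x \<in> carrier G"
  shows "flux f \<gamma> (\<gamma> \<otimes> x) = - flux f (inv \<gamma>) x"
proof -
  have "D f \<gamma> (\<gamma> \<otimes> x) = - D f (inv \<gamma>) x"
    using assms by (simp add: D_def m_assoc[symmetric])
  then show ?thesis by (simp add: flux_def)
qed

lemma summable_flux:
  assumes "in_D f" "\<gamma> \<in> K"
  shows "(\<lambda>x. cmod (flux f \<gamma> x) powr q) summable_on carrier G"
  using assms by (simp add: norm_flux_powr in_D_def)

text \<open>The Laplacian is a finite combination of fluxes, each in l^q. So its q-norm is a genuine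
  infinite sum and not the default value 0, and Hoelder's inequality may be applied to it.\<close>

lemma summable_lap:
  assumes f: "in_D f"
  shows "(\<lambda>x. cmod (lap f x) powr q) summable_on carrier G"
proof -
  have "(\<lambda>x. cmod (\<Sum>\<gamma>\<in>L. flux f \<gamma> x * of_real (m \<gamma>)) powr q) summable_on carrier G"
    if "finite L" "L \<subseteq> K" for L
    using that
  proof (induction L rule: finite_induct)
    case (insert \<gamma> L)
    have "(\<lambda>x. cmod (flux f \<gamma> x * of_real (m \<gamma>)) powr q) summable_on carrier G"
      using summable_flux[OF f] insert.prems
      by (auto simp: norm_mult powr_mult intro: summable_on_cmult_left)
    then show ?case
      using insert q_gt_1 by (simp add: summable_on_powr_add)
  qed simp
  then show ?thesis using finite_K by (simp add: lap_def)
qed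

text \<open>Substituting \<open>x \<mapsto> \<gamma> x\<close> and then \<open>\<gamma> \<mapsto> \<gamma>\<^sup>-\<^sup>1\<close> turns the term with the translate of \<open>u\<close>
  into minus the other one, whence the factor \<open>-2\<close>.\<close>

lemma Green:
  assumes f: "in_D f" and u: "lp u"
  shows "((\<lambda>x. \<Sum>\<gamma>\<in>K. of_real (m \<gamma>) * (cnj (flux f \<gamma> x) * D u \<gamma> x)) has_sum
    - 2 * (\<Sum>\<^sub>\<infinity>x\<in>carrier G. cnj (lap f x) * u x)) (carrier G)"
proof -
  define I where "I \<gamma> = (\<Sum>\<^sub>\<infinity>x\<in>carrier G. cnj (flux f \<gamma> x) * u x)" for \<gamma>
  have I: "((\<lambda>x. cnj (flux f \<gamma> x) * u x) has_sum I \<gamma>) (carrier G)" if "\<gamma> \<in> K" for \<gamma>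
  proof -
    have "(\<lambda>x. norm (u x * cnj (flux f \<gamma> x))) summable_on carrier G"
      using f u that by (intro Hoelder_infsum(1)[OF p q]) (auto intro: summable_flux)
    then show ?thesis
      unfolding I_def using abs_summable_summable[of "\<lambda>x. u x * cnj (flux f \<gamma> x)"]
      by (simp add: mult.commute)
  qed
  have J: "((\<lambda>x. cnj (flux f \<gamma> x) * u (inv \<gamma> \<otimes> x)) has_sum - I (inv \<gamma>)) (carrier G)" if \<gamma>: "\<gamma> \<in> K" for \<gamma>
  proof -
    have g: "\<gamma> \<in> carrier G" using \<gamma> by (rule K_carrier)
    have "((\<lambda>x. - (cnj (flux f (inv \<gamma>) x) * u x)) has_sum - I (inv \<gamma>)) (carrier G)"
      using I[OF inv_in_K[OF \<gamma>]] by (simp add: has_sum_uminus)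
    then have "((\<lambda>x. cnj (flux f \<gamma> (\<gamma> \<otimes> x)) * u (inv \<gamma> \<otimes> (\<gamma> \<otimes> x))) has_sum - I (inv \<gamma>)) (carrier G)"
      using g by (subst has_sum_cong[where g = "\<lambda>x. - (cnj (flux f (inv \<gamma>) x) * u x)"])
        (simp_all add: flux_antisymmetric m_assoc[symmetric])
    then show ?thesis
      using has_sum_reindex_bij_betw[OF bij_betw_mult_left[OF g],
        of "\<lambda>x. cnj (flux f \<gamma> x) * u (inv \<gamma> \<otimes> x)"] by simp
  qed
  have "((\<lambda>x. \<Sum>\<gamma>\<in>K. of_real (m \<gamma>) * (cnj (flux f \<gamma> x) * u x)) has_sum (\<Sum>\<gamma>\<in>K. of_real (m \<gamma>) * I \<gamma>)) (carrier G)"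
    using I by (intro has_sum_sum has_sum_cmult_right)
  then have "((\<lambda>x. cnj (lap f x) * u x) has_sum (\<Sum>\<gamma>\<in>K. of_real (m \<gamma>) * I \<gamma>)) (carrier G)"
    by (simp add: lap_def sum_distrib_right sum_distrib_left mult_ac)
  then have lap: "(\<Sum>\<^sub>\<infinity>x\<in>carrier G. cnj (lap f x) * u x) = (\<Sum>\<gamma>\<in>K. of_real (m \<gamma>) * I \<gamma>)"
    by (rule infsumI)
  have "((\<lambda>x. \<Sum>\<gamma>\<in>K. of_real (m \<gamma>) * (cnj (flux f \<gamma> x) * u (inv \<gamma> \<otimes> x) + - (cnj (flux f \<gamma> x) * u x))) has_sum
      (\<Sum>\<gamma>\<in>K. of_real (m \<gamma>) * (- I (inv \<gamma>) + - I \<gamma>))) (carrier G)"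
    using I J by (intro has_sum_sum has_sum_cmult_right has_sum_add) (simp_all add: has_sum_uminus)
  moreover have "(\<Sum>\<gamma>\<in>K. of_real (m \<gamma>) * (- I (inv \<gamma>) + - I \<gamma>)) = - 2 * (\<Sum>\<gamma>\<in>K. of_real (m \<gamma>) * I \<gamma>)"
  proof -
    have "(\<Sum>\<gamma>\<in>K. of_real (m \<gamma>) * I (inv \<gamma>)) = (\<Sum>\<gamma>\<in>K. of_real (m (inv \<gamma>)) * I (inv \<gamma>))"
      by (intro sum.cong) (auto simp: m_inv)
    also have "\<dots> = (\<Sum>\<gamma>\<in>K. of_real (m \<gamma>) * I \<gamma>)"
      by (rule sum.reindex_bij_betw[OF bij_inv_K])
    finally show ?thesis
      by (simp add: distrib_left right_diff_distrib sum.distrib sum_subtractf sum_negf)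
  qed
  ultimately show ?thesis
    unfolding lap by (simp add: D_def right_diff_distrib)
qed

text \<open>Green's formula with u = f, where the pairing of flux and gradient is the energy
  density, followed by Hoelder's inequality.\<close>

lemma energy_le_lap:
  assumes f: "lp f"
  shows "energy f \<le> 2 * (\<Sum>\<^sub>\<infinity>x\<in>carrier G. cmod (lap f x) powr q) powr (1 / q) * psum f powr (1 / p)"
proof -
  have "((\<lambda>x. of_real (edens f x)) has_sum (of_real (energy f) :: complex)) (carrier G)"
    unfolding energy_def using summable_edens[OF in_D_lp[OF f]] by (intro has_sum_of_real has_sum_infsum)
  moreover have "of_real (edens f x) = (\<Sum>\<gamma>\<in>K. of_real (m \<gamma>) * (cnj (flux f \<gamma> x) * D f \<gamma> x))" for x
    by (simp add: edens_def cnj_flux_mult)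
  ultimately have "of_real (energy f) = - 2 * (\<Sum>\<^sub>\<infinity>x\<in>carrier G. cnj (lap f x) * f x)"
    using Green[OF in_D_lp[OF f] f] has_sum_unique by simp blast
  then have "energy f = 2 * cmod (\<Sum>\<^sub>\<infinity>x\<in>carrier G. f x * cnj (lap f x))"
    using energy_nonneg[of f] by (metis (no_types, lifting) infsum_cong mult.commute norm_minus_cancel norm_mult norm_numeral norm_of_real abs_of_nonneg mult_minus_left)
  also have "\<dots> \<le> 2 * (psum f powr (1 / p) * (\<Sum>\<^sub>\<infinity>x\<in>carrier G. cmod (lap f x) powr q) powr (1 / q))"
    unfolding psum_def using Hoelder_infsum(2)[OF p q f, of "\<lambda>x. cnj (lap f x)"] summable_lap[OF in_D_lp[OF f]]
    by simp
  finally show ?thesis by (simp add: mult_ac)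
qed

lemma lp_finite_support:
  assumes "finite A" "\<And>x. x \<in> carrier G - A \<Longrightarrow> u x = 0"
  shows "lp u"
proof -
  have "(\<lambda>x. cmod (u x) powr p) summable_on (carrier G \<inter> A)"
    using assms(1) by simp
  then show ?thesis
    by (subst summable_on_cong_neutral[where T = "carrier G \<inter> A" and g = "\<lambda>x. cmod (u x) powr p"]) (use assms in auto)
qed

lemma psum_finite_support:
  assumes "finite A" "A \<subseteq> carrier G" "\<And>x. x \<in> carrier G - A \<Longrightarrow> u x = 0"
  shows "psum u = (\<Sum>x\<in>A. cmod (u x) powr p)"
proof -
  have "psum u = (\<Sum>\<^sub>\<infinity>x\<in>A. cmod (u x) powr p)"
    unfolding psum_def by (rule infsum_cong_neutral) (use assms in auto)
  then show ?thesis using assms(1) by simp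
qed

text \<open>A finitely supported direction u changes the density at finitely many points only. Hence
  a finite sum is differentiated, the rest is constant in t, and no derivative has to be exchanged
  with an infinite sum.\<close>

lemma energy_derivative:
  assumes f: "in_D f" and A: "finite A" "A \<subseteq> carrier G" and u: "\<And>x. x \<in> carrier G - A \<Longrightarrow> u x = 0"
  shows "((\<lambda>t::real. energy (\<lambda>x. f x + of_real t * u x)) has_real_derivative
    - 2 * p * Re (\<Sum>x\<in>A. cnj (lap f x) * u x)) (at 0)"
proof -
  \<comment> \<open>The points x at which x or some \<gamma>^-1 x lies in A; outside T the gradient
    of u vanishes.\<close>
  define T where "T = A \<union> (\<lambda>(\<gamma>, x). \<gamma> \<otimes> x) ` (K \<times> A)"
  have T: "finite T" "T \<subseteq> carrier G"
    using A finite_K K_carrier by (auto simp: T_def)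
  have Du: "D u \<gamma> x = 0" if "\<gamma> \<in> K" "x \<in> carrier G - T" for \<gamma> x
  proof -
    have g: "\<gamma> \<in> carrier G" using that K_carrier by blast
    have "inv \<gamma> \<otimes> x \<notin> A"
    proof
      assume "inv \<gamma> \<otimes> x \<in> A"
      then have "\<gamma> \<otimes> (inv \<gamma> \<otimes> x) \<in> T" using that by (auto simp: T_def)
      then show False using that g by (simp add: m_assoc[symmetric])
    qed
    then show ?thesis using that g u by (simp add: D_def T_def)
  qed
  have Dt: "D (\<lambda>x. f x + of_real t * u x) \<gamma> x = D f \<gamma> x + of_real t * D u \<gamma> x" for t \<gamma> x
    by (simp add: D_def right_diff_distrib)
  have lpu: "lp u" using lp_finite_support[OF A(1) u] .
  have split: "energy (\<lambda>x. f x + of_real t * u x)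
      = (\<Sum>x\<in>T. \<Sum>\<gamma>\<in>K. m \<gamma> * cmod (D f \<gamma> x + of_real t * D u \<gamma> x) powr p) + (\<Sum>\<^sub>\<infinity>x\<in>carrier G - T. edens f x)" for t
  proof -
    let ?g = "\<lambda>x. f x + of_real t * u x"
    have "lp (\<lambda>x. of_real t * u x)"
      using lpu by (simp add: norm_mult powr_mult summable_on_cmult_right)
    then have g: "in_D ?g" using in_D_add[OF f in_D_lp] by simp
    have eq: "edens ?g x = edens f x" if "x \<in> carrier G - T" for x
      using that Du by (simp add: edens_def Dt)
    have "energy ?g = infsum (edens ?g) (T \<union> (carrier G - T))"
      unfolding energy_def using T by (simp add: Un_absorb1)
    also have "\<dots> = infsum (edens ?g) T + infsum (edens ?g) (carrier G - T)"
      using T summable_edens[OF g] by (intro infsum_Un_disjoint summable_on_cofin_subset) auto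
    also have "infsum (edens ?g) (carrier G - T) = infsum (edens f) (carrier G - T)"
      by (intro infsum_cong eq)
    finally show ?thesis using T by (simp add: edens_def[abs_def] Dt)
  qed
  have deriv: "((\<lambda>t::real. energy (\<lambda>x. f x + of_real t * u x)) has_real_derivative
     (\<Sum>x\<in>T. \<Sum>\<gamma>\<in>K. m \<gamma> * (p * cmod (D f \<gamma> x) powr (p - 2) * Re (cnj (D f \<gamma> x) * D u \<gamma> x))) + 0) (at 0)"
    unfolding split
    by (intro DERIV_add DERIV_const DERIV_sum DERIV_cmult has_real_derivative_cmod_powr p)
  have pairing: "(\<Sum>x\<in>T. \<Sum>\<gamma>\<in>K. m \<gamma> * (p * cmod (D f \<gamma> x) powr (p - 2) * Re (cnj (D f \<gamma> x) * D u \<gamma> x)))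
      = p * Re (\<Sum>x\<in>T. \<Sum>\<gamma>\<in>K. of_real (m \<gamma>) * (cnj (flux f \<gamma> x) * D u \<gamma> x))"
  proof -
    have "m \<gamma> * (p * cmod (D f \<gamma> x) powr (p - 2) * Re (cnj (D f \<gamma> x) * D u \<gamma> x))
      = p * Re (of_real (m \<gamma>) * (cnj (flux f \<gamma> x) * D u \<gamma> x))" for \<gamma> x
      by (simp add: flux_def algebra_simps)
    then show ?thesis by (simp only: sum_distrib_left Re_sum)
  qed
  \<comment> \<open>Since D u vanishes off T, the finite sum equals the sum over the whole group, to
    which Green's formula applies.\<close>
  have green: "(\<Sum>x\<in>T. \<Sum>\<gamma>\<in>K. of_real (m \<gamma>) * (cnj (flux f \<gamma> x) * D u \<gamma> x)) = - 2 * (\<Sum>x\<in>A. cnj (lap f x) * u x)"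
  proof -
    have "(\<Sum>x\<in>T. \<Sum>\<gamma>\<in>K. of_real (m \<gamma>) * (cnj (flux f \<gamma> x) * D u \<gamma> x))
        = (\<Sum>\<^sub>\<infinity>x\<in>T. \<Sum>\<gamma>\<in>K. of_real (m \<gamma>) * (cnj (flux f \<gamma> x) * D u \<gamma> x))"
      using T by simp
    also have "\<dots> = (\<Sum>\<^sub>\<infinity>x\<in>carrier G. \<Sum>\<gamma>\<in>K. of_real (m \<gamma>) * (cnj (flux f \<gamma> x) * D u \<gamma> x))"
      by (rule infsum_cong_neutral) (use T Du in auto)
    also have "\<dots> = - 2 * (\<Sum>\<^sub>\<infinity>x\<in>carrier G. cnj (lap f x) * u x)"
      using Green[OF f lpu] by (rule infsumI)
    also have "(\<Sum>\<^sub>\<infinity>x\<in>carrier G. cnj (lap f x) * u x) = (\<Sum>\<^sub>\<infinity>x\<in>A. cnj (lap f x) * u x)"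
      by (rule infsum_cong_neutral) (use A u in auto)
    finally show ?thesis using A by simp
  qed
  show ?thesis
    by (rule DERIV_cong[OF deriv]) (unfold pairing green, simp)
qed

subsection \<open>Almost-minimizers of the energy\<close>

definition ldist :: "('a \<Rightarrow> complex) \<Rightarrow> ('a \<Rightarrow> complex) \<Rightarrow> real"
  where "ldist f g = psum (\<lambda>x. f x - g x) powr (1 / p)"

lemma pointwise_le_psum:
  assumes "lp f" "x \<in> carrier G"
  shows "cmod (f x) \<le> psum f powr (1 / p)"
proof -
  have "cmod (f x) powr p \<le> psum f"
    unfolding psum_def using finite_sum_le_infsum[OF assms(1), of "{x}"] assms(2) by simp
  then have "(cmod (f x) powr p) powr (1 / p) \<le> psum f powr (1 / p)"
    using p by (intro powr_mono2) auto
  then show ?thesis using p by (simp add: powr_powr)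
qed

lemma lp_diff: "f \<in> ell G p \<Longrightarrow> g \<in> ell G p \<Longrightarrow> lp (\<lambda>x. f x - g x)"
  using p by (intro summable_on_powr_diff) (auto simp: ell_iff)

sublocale ell: Metric_space "ell G p" ldist
proof
  show "0 \<le> ldist f g" for f g by (simp add: ldist_def)
  show "ldist f g = ldist g f" for f g by (simp add: ldist_def psum_def norm_minus_commute)
  show "ldist f g = 0 \<longleftrightarrow> f = g" if fg: "f \<in> ell G p" "g \<in> ell G p" for f g
  proof
    assume "ldist f g = 0"
    then have "cmod (f x - g x) \<le> 0" if "x \<in> carrier G" for x
      using pointwise_le_psum[OF lp_diff[OF fg] that] by (simp add: ldist_def)
    then show "f = g" using fg by (intro extensionalityI[of _ "carrier G"]) (auto simp: ell_iff)
  qed (simp add: ldist_def psum_def)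
  show "ldist f h \<le> ldist f g + ldist g h" if "f \<in> ell G p" "g \<in> ell G p" "h \<in> ell G p" for f g h
    using Minkowski_infsum[of p "\<lambda>x. f x - g x" "carrier G" "\<lambda>x. g x - h x"] lp_diff that p
    by (simp add: ldist_def psum_def)
qed

lemma ell_pointwise_limit:
  assumes "limitin ell.mtopology \<sigma> h sequentially" "x \<in> carrier G"
  shows "(\<lambda>n. \<sigma> n x) \<longlonglongrightarrow> h x"
proof (rule LIMSEQ_I)
  fix r :: real assume "r > 0"
  then obtain N where N: "\<And>n. n \<ge> N \<Longrightarrow> \<sigma> n \<in> ell G p \<and> ldist (\<sigma> n) h < r" and h: "h \<in> ell G p"
    using assms(1) unfolding ell.limit_metric_sequentially by blast
  have "norm (\<sigma> n x - h x) < r" if "n \<ge> N" for n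
    using pointwise_le_psum[OF lp_diff[of "\<sigma> n" h] assms(2)] N[OF that] h by (simp add: ldist_def)
  then show "\<exists>N. \<forall>n\<ge>N. norm (\<sigma> n x - h x) < r" by blast
qed

lemma ell_complete: "ell.mcomplete"
  unfolding ell.mcomplete_def
proof (intro allI impI)
  fix \<sigma> assume \<sigma>: "ell.MCauchy \<sigma>"
  then have \<sigma>_ell: "\<sigma> n \<in> ell G p" for n by (auto simp: ell.MCauchy_def)
  have C: "\<exists>N. \<forall>n\<ge>N. \<forall>k\<ge>N. ldist (\<sigma> n) (\<sigma> k) < e" if "e > 0" for e
  proof -
    obtain N where "\<forall>n k. N \<le> n \<longrightarrow> N \<le> k \<longrightarrow> ldist (\<sigma> n) (\<sigma> k) < e"
      using \<sigma> \<open>e > 0\<close> by (force simp: ell.MCauchy_def)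
    then show ?thesis by (intro exI[of _ N]) simp
  qed
  have "Cauchy (\<lambda>n. \<sigma> n x)" if "x \<in> carrier G" for x
  proof (rule metric_CauchyI)
    fix e :: real assume "e > 0"
    then obtain N where N: "\<And>n k. n \<ge> N \<Longrightarrow> k \<ge> N \<Longrightarrow> ldist (\<sigma> n) (\<sigma> k) < e" using C by blast
    have "dist (\<sigma> n x) (\<sigma> k x) < e" if "n \<ge> N" "k \<ge> N" for n k
      using pointwise_le_psum[OF lp_diff[OF \<sigma>_ell \<sigma>_ell] \<open>x \<in> carrier G\<close>, of n k] N[OF that]
      by (simp add: ldist_def dist_norm)
    then show "\<exists>M. \<forall>m\<ge>M. \<forall>n\<ge>M. dist (\<sigma> m x) (\<sigma> n x) < e" by blast
  qed
  then have "\<exists>l. (\<lambda>n. \<sigma> n x) \<longlonglongrightarrow> l" if "x \<in> carrier G" for x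
    using that by (simp add: Cauchy_convergent_iff convergent_def)
  then obtain l where l: "\<And>x. x \<in> carrier G \<Longrightarrow> (\<lambda>n. \<sigma> n x) \<longlonglongrightarrow> l x" by metis
  define h where "h = restrict l (carrier G)"
  have lim: "(\<lambda>n. \<sigma> n x) \<longlonglongrightarrow> h x" if "x \<in> carrier G" for x
    using l that by (simp add: h_def)
  \<comment> \<open>With k fixed, the Cauchy bound passes to the pointwise limit by Fatou. It is
    used with e = 1 to put h into l^p and with e / 2 to get convergence.\<close>
  have tail: "lp (\<lambda>x. h x - \<sigma> k x) \<and> ldist h (\<sigma> k) \<le> e"
    if "\<And>n. n \<ge> N \<Longrightarrow> ldist (\<sigma> n) (\<sigma> k) < e" "e > 0" for N k e
  proof -
    have le: "psum (\<lambda>x. \<sigma> n x - \<sigma> k x) \<le> e powr p" if "n \<ge> N" for n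
    proof -
      have "(psum (\<lambda>x. \<sigma> n x - \<sigma> k x) powr (1 / p)) powr p \<le> e powr p"
        using \<open>\<And>n. n \<ge> N \<Longrightarrow> ldist (\<sigma> n) (\<sigma> k) < e\<close>[OF that] p
        by (intro powr_mono2) (auto simp: ldist_def)
      then show ?thesis using p by (simp add: powr_powr psum_nonneg)
    qed
    have "(\<lambda>n. \<sigma> n x - \<sigma> k x) \<longlonglongrightarrow> h x - \<sigma> k x" if "x \<in> carrier G" for x
      using lim[OF that] by (intro tendsto_diff tendsto_const)
    then have "lp (\<lambda>x. h x - \<sigma> k x)" "psum (\<lambda>x. h x - \<sigma> k x) \<le> e powr p"
      unfolding psum_def
      using Fatou_powr[of "carrier G" "\<lambda>n x. \<sigma> n x - \<sigma> k x" "\<lambda>x. h x - \<sigma> k x" p N "e powr p"]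
        le p lp_diff[OF \<sigma>_ell \<sigma>_ell] by (auto simp: psum_def)
    moreover from this(2) have "psum (\<lambda>x. h x - \<sigma> k x) powr (1 / p) \<le> (e powr p) powr (1 / p)"
      using p by (intro powr_mono2) (auto simp: psum_nonneg)
    ultimately show ?thesis using p \<open>e > 0\<close> by (simp add: ldist_def powr_powr)
  qed
  have h: "h \<in> ell G p"
  proof -
    obtain N where "\<And>n k. n \<ge> N \<Longrightarrow> k \<ge> N \<Longrightarrow> ldist (\<sigma> n) (\<sigma> k) < 1" using C[of 1] by auto
    then have "lp (\<lambda>x. h x - \<sigma> N x)" using tail[of N N 1] by auto
    then have "lp (\<lambda>x. (h x - \<sigma> N x) + \<sigma> N x)"
      using \<sigma>_ell[of N] p by (intro summable_on_powr_add) (auto simp: ell_iff)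
    then show ?thesis by (simp add: h_def ell_iff)
  qed
  have "limitin ell.mtopology \<sigma> h sequentially"
    unfolding ell.limit_metric_sequentially
  proof (intro conjI h allI impI)
    fix e :: real assume "e > 0"
    then obtain N where N: "\<And>n k. n \<ge> N \<Longrightarrow> k \<ge> N \<Longrightarrow> ldist (\<sigma> n) (\<sigma> k) < e / 2"
      using C[of "e / 2"] by auto
    have "ldist (\<sigma> k) h < e" if "k \<ge> N" for k
      using tail[of N k "e / 2"] N that \<open>e > 0\<close> ell.commute[of h "\<sigma> k"] by auto
    then show "\<exists>N. \<forall>n\<ge>N. \<sigma> n \<in> ell G p \<and> ldist (\<sigma> n) h < e" using \<sigma>_ell by blast
  qed
  then show "\<exists>h. limitin ell.mtopology \<sigma> h sequentially" by blast
qed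

text \<open>Convergence in l^p is used only through its pointwise consequence: finite partial sums
  of the density converge, and each is bounded by b.\<close>

lemma energy_lower_semicontinuous:
  assumes F: "in_D F" and lim: "limitin ell.mtopology \<sigma> h sequentially" and "range \<sigma> \<subseteq> ell G p"
    and le: "\<And>n. energy (\<lambda>x. F x + \<sigma> n x) \<le> b"
  shows "energy (\<lambda>x. F x + h x) \<le> b"
proof -
  have \<sigma>: "in_D (\<lambda>x. F x + \<sigma> n x)" for n
    using range_subsetD[OF assms(3), of n] by (intro in_D_add F in_D_lp) (simp add: ell_iff)
  have "(\<Sum>x\<in>A. edens (\<lambda>x. F x + h x) x) \<le> b" if A: "finite A" "A \<subseteq> carrier G" for A
  proof (rule LIMSEQ_le_const2)
    have "(\<lambda>n. D (\<lambda>x. F x + \<sigma> n x) \<gamma> x) \<longlonglongrightarrow> D (\<lambda>x. F x + h x) \<gamma> x"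
      if "\<gamma> \<in> carrier G" "x \<in> carrier G" for \<gamma> x
      unfolding D_def using that
      by (intro tendsto_diff tendsto_add tendsto_const ell_pointwise_limit[OF lim]) auto
    then show "(\<lambda>n. \<Sum>x\<in>A. edens (\<lambda>x. F x + \<sigma> n x) x) \<longlonglongrightarrow> (\<Sum>x\<in>A. edens (\<lambda>x. F x + h x) x)"
      unfolding edens_def using A p K_carrier
      by (intro tendsto_sum tendsto_mult tendsto_const tendsto_powr' tendsto_norm) auto
    have "(\<Sum>x\<in>A. edens (\<lambda>x. F x + \<sigma> n x) x) \<le> b" for n
      using finite_sum_le_infsum[OF summable_edens[OF \<sigma>] A] le[of n] edens_nonneg
      unfolding energy_def by (meson order_trans)
    then show "\<exists>N. \<forall>n\<ge>N. (\<Sum>x\<in>A. edens (\<lambda>x. F x + \<sigma> n x) x) \<le> b" by blast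
  qed
  then show ?thesis
    unfolding energy_def by (intro nonneg_finite_sums_bounded(2)) (auto simp: edens_nonneg)
qed

text \<open>An almost-minimizer \<open>h\<close> of the \<open>1/p\<close>-th power of the energy has small slope there, and the
  slope is \<open>2 \<parallel>\<Delta>\<^sub>p f\<parallel>\<^sub>q / E(f)\<^bsup>1 - 1/p\<^esup>\<close>.\<close>

lemma exists_small_slope:
  assumes F: "in_D F" and C: "C > 0"
  obtains h where "h \<in> ell G p"
    "energy (\<lambda>x. F x + h x) > 0 \<Longrightarrow>
      (\<Sum>\<^sub>\<infinity>x\<in>carrier G. cmod (lap (\<lambda>x. F x + h x) x) powr q) powr (1 / q)
        \<le> C / 2 * energy (\<lambda>x. F x + h x) powr (1 - 1 / p)"
proof -
  define \<phi> where "\<phi> h = energy (\<lambda>x. F x + h x) powr (1 / p)" for h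
  have zero: "restrict (\<lambda>x. 0) (carrier G) \<in> ell G p"
    by (subst restrict_ell) simp
  obtain h where h: "h \<in> ell G p" and min: "\<And>y. y \<in> ell G p \<Longrightarrow> \<phi> y + C * ldist h y \<le> \<phi> h \<Longrightarrow> y = h"
  proof (rule ell.Ekeland[OF ell_complete _ C, of \<phi>])
    show "ell G p \<noteq> {}" using zero by blast
    show "0 \<le> \<phi> h" for h by (simp add: \<phi>_def)
    fix \<sigma> x b assume lim: "limitin ell.mtopology \<sigma> x sequentially" and \<sigma>: "range \<sigma> \<subseteq> ell G p" and b: "\<And>n. \<phi> (\<sigma> n) \<le> b"
    have b0: "b \<ge> 0" using b[of 0] by (smt (verit) \<phi>_def powr_ge_zero)
    have "energy (\<lambda>x. F x + \<sigma> n x) \<le> b powr p" for n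
    proof -
      have "\<phi> (\<sigma> n) powr p \<le> b powr p" using b p by (intro powr_mono2) (auto simp: \<phi>_def)
      then show ?thesis using p by (simp add: \<phi>_def powr_powr energy_nonneg)
    qed
    then have "energy (\<lambda>y. F y + x y) \<le> b powr p"
      by (rule energy_lower_semicontinuous[OF F lim \<sigma>])
    then have "\<phi> x \<le> (b powr p) powr (1 / p)"
      unfolding \<phi>_def using p by (intro powr_mono2) (auto simp: energy_nonneg)
    then show "\<phi> x \<le> b" using p b0 by (simp add: powr_powr)
  qed blast
  define f where "f = (\<lambda>x. F x + h x)"
  have f: "in_D f" unfolding f_def using h by (intro in_D_add F in_D_lp) (simp add: ell_iff)
  show thesis
  proof (rule that[OF h], fold f_def)
    assume pos: "energy f > 0"
    show "(\<Sum>\<^sub>\<infinity>x\<in>carrier G. cmod (lap f x) powr q) powr (1 / q) \<le> C / 2 * energy f powr (1 - 1 / p)"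
    proof (rule powr_dual_bound[OF p q])
      show "0 \<le> C / 2 * energy f powr (1 - 1 / p)" using C by simp
      fix A and u :: "'a \<Rightarrow> complex" assume A: "finite A" "A \<subseteq> carrier G"
      \<comment> \<open>The duality bound tests arbitrary u on A; cutting off outside A yields an
        admissible direction of finite support.\<close>
      define v where "v x = (if x \<in> A then u x else 0)" for x
      have v0: "v x = 0" if "x \<in> carrier G - A" for x using that by (simp add: v_def)
      define R where "R = Re (\<Sum>x\<in>A. cnj (lap f x) * v x)"
      define \<psi> where "\<psi> t = energy (\<lambda>x. f x + of_real t * v x) powr (1 / p)" for t :: real
      \<comment> \<open>The p-th root is differentiated at a positive value, which is where
        \<open>pos\<close> enters.\<close>
      have D0: "(\<psi> has_real_derivative 1 / p * energy f powr (1 / p - 1) * (- 2 * p * R)) (at 0)"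
        unfolding \<psi>_def
        using DERIV_fun_powr[OF energy_derivative[where u = v, OF f A v0, folded R_def], where r = "1 / p"] pos p
        by simp
      \<comment> \<open>A one-sided derivative is enough: the Ekeland inequality is divided by t >
        0, and a bound for -u comes from testing -u itself.\<close>
      have "(\<psi> has_real_derivative - 2 * energy f powr (1 / p - 1) * R) (at 0 within {0<..})"
        by (rule has_field_derivative_at_within[OF DERIV_cong[OF D0]]) (use p in simp)
      then have lim: "((\<lambda>t. (\<psi> t - \<psi> 0) / t) \<longlongrightarrow> - 2 * energy f powr (1 / p - 1) * R) (at_right 0)"
        by (simp add: has_field_derivative_iff)
      have "(\<psi> t - \<psi> 0) / t \<ge> - C * psum v powr (1 / p)" if t: "t > 0" for t
      proof -
        let ?y = "restrict (\<lambda>x. h x + of_real t * v x) (carrier G)"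
        have "lp (\<lambda>x. of_real t * v x)" by (rule lp_finite_support[OF A(1)]) (simp add: v_def)
        then have y: "?y \<in> ell G p"
          using h p by (subst restrict_ell) (auto simp: ell_iff intro: summable_on_powr_add)
        have "psum (\<lambda>x. h x - ?y x) = psum (\<lambda>x. of_real (- t) * v x)"
          by (rule psum_cong) simp
        then have d: "ldist h ?y = t * psum v powr (1 / p)"
          using t p unfolding ldist_def psum_scale by (simp add: powr_mult powr_powr psum_nonneg)
        have \<phi>y: "\<phi> ?y = \<psi> t"
          unfolding \<phi>_def \<psi>_def f_def by (subst energy_cong) auto
        have \<phi>h: "\<phi> h = \<psi> 0" by (simp add: \<phi>_def \<psi>_def f_def)
        \<comment> \<open>If this failed, minimality would give ?y = h, and then the two sides would
          be equal.\<close>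
        have "\<phi> ?y + C * ldist h ?y \<ge> \<phi> h"
        proof (rule ccontr)
          assume less: "\<not> ?thesis"
          then have "?y = h" using min[OF y] by simp
          then show False using less ell.zero[OF h h] by simp
        qed
        then have "- (C * (t * psum v powr (1 / p))) \<le> \<psi> t - \<psi> 0"
          unfolding d \<phi>y \<phi>h by simp
        then show ?thesis using t by (simp add: pos_le_divide_eq mult_ac)
      qed
      then have "- C * psum v powr (1 / p) \<le> - 2 * energy f powr (1 / p - 1) * R"
        by (intro tendsto_lowerbound[OF lim] eventually_at_rightI[of 0 1]) auto
      then have "2 * (energy f powr (1 / p - 1) * R) \<le> C * psum v powr (1 / p)" by simp
      then have "energy f powr (1 - 1 / p) * (2 * (energy f powr (1 / p - 1) * R))
          \<le> energy f powr (1 - 1 / p) * (C * psum v powr (1 / p))"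
        by (intro mult_left_mono) auto
      also have "energy f powr (1 - 1 / p) * (2 * (energy f powr (1 / p - 1) * R))
          = 2 * (energy f powr (1 - 1 / p) * energy f powr (1 / p - 1)) * R"
        by simp
      also have "energy f powr (1 - 1 / p) * energy f powr (1 / p - 1) = 1"
        using pos by (simp flip: powr_add)
      finally have "R \<le> C / 2 * energy f powr (1 - 1 / p) * psum v powr (1 / p)"
        by (simp add: mult_ac)
      moreover have "psum v = (\<Sum>x\<in>A. cmod (u x) powr p)"
        using psum_finite_support[where u = v, OF A v0] by (simp add: v_def)
      ultimately show "Re (\<Sum>x\<in>A. cnj (lap f x) * u x)
          \<le> C / 2 * energy f powr (1 - 1 / p) * (\<Sum>x\<in>A. cmod (u x) powr p) powr (1 / p)"
        by (simp add: v_def R_def)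
    qed
  qed
qed

subsection \<open>The Poincare inequality\<close>

text \<open>Each region T n contains the support of h n and its K-neighbours, so the gradients of
  the bumps do not interact and the energies add up to a geometric series. Yet every region
  contributes a fixed amount to |F - c|^p: the norm of h n if c = 0, and the value at a zero of h n
  otherwise.\<close>

lemma sum_of_disjoint_bumps:
  assumes fin: "\<And>n. finite (T n)" and TG: "\<And>n. T n \<subseteq> carrier G"
    and disj: "\<And>k n. k < n \<Longrightarrow> T n \<inter> T k = {}"
    and supp: "\<And>n x. x \<in> carrier G \<Longrightarrow> h n x \<noteq> 0 \<Longrightarrow> x \<in> T n \<and> (\<forall>\<gamma>\<in>K. \<gamma> \<otimes> x \<in> T n)"
    and zero: "\<And>n. \<exists>z\<in>T n. h n z = 0"
    and psum_h: "\<And>n. psum (h n) = 1" and energy_h: "\<And>n. energy (h n) \<le> (1 / 2) ^ n"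
  obtains F where "in_D F" "\<And>c. \<not> lp (\<lambda>x. F x - c)"
proof -
  have uniq: "k = n" if "x \<in> T k" "x \<in> T n" for x k n
    using that disj[of k n] disj[of n k] by (cases k n rule: linorder_cases) auto
  \<comment> \<open>Disjointness makes the index unique, so on the group F is the sum of all
    bumps.\<close>
  define idx where "idx x = (SOME n. x \<in> T n)" for x
  have idx: "idx x = n" if "x \<in> T n" for x n
    unfolding idx_def by (rule some_equality) (use that uniq in auto)
  define F where "F x = (if \<exists>n. x \<in> T n then h (idx x) x else 0)" for x
  have F_T: "F x = h n x" if "x \<in> T n" for x n
    using that idx by (auto simp: F_def)
  have F_nz: "\<exists>n. x \<in> T n \<and> h n x \<noteq> 0" if "F x \<noteq> 0" for x
    using that idx by (auto simp: F_def split: if_splits)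
  have lp_h: "lp (h n)" for n
    by (rule lp_finite_support[OF fin[of n]]) (use supp[of _ n] in auto)
  \<comment> \<open>The neighbour ?y may leave T n. If F is nonzero there because of bump k, then x
    = \<gamma> ?y lies in T k as well, whence k = n.\<close>
  have D_T: "D F \<gamma> x = D (h n) \<gamma> x" if \<gamma>: "\<gamma> \<in> K" and x: "x \<in> T n" for \<gamma> x n
  proof -
    let ?y = "inv \<gamma> \<otimes> x"
    have g: "\<gamma> \<in> carrier G" "x \<in> carrier G" using \<gamma> x K_carrier TG by auto
    then have y: "?y \<in> carrier G" "\<gamma> \<otimes> ?y = x" by (auto simp: m_assoc[symmetric])
    have "F ?y = h n ?y"
    proof (cases "F ?y = 0")
      case True
      then show ?thesis using supp[OF y(1), of n] F_T by fastforce
    next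
      case False
      then obtain k where k: "?y \<in> T k" "h k ?y \<noteq> 0" using F_nz by blast
      then have "x \<in> T k" using supp[OF y(1) k(2)] \<gamma> y(2) by force
      then have "k = n" using uniq x by blast
      then show ?thesis using F_T k by blast
    qed
    then show ?thesis using F_T[OF x] by (simp add: D_def)
  qed
  have D_out: "D F \<gamma> x = 0" if \<gamma>: "\<gamma> \<in> K" and x: "x \<in> carrier G" "\<And>n. x \<notin> T n" for \<gamma> x
  proof -
    let ?y = "inv \<gamma> \<otimes> x"
    have g: "\<gamma> \<in> carrier G" using \<gamma> K_carrier by auto
    then have y: "?y \<in> carrier G" "\<gamma> \<otimes> ?y = x" using x by (auto simp: m_assoc[symmetric])
    have "F ?y = 0"
    proof (rule ccontr)
      assume "F ?y \<noteq> 0"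
      then obtain k where k: "h k ?y \<noteq> 0" using F_nz by blast
      then show False using supp[OF y(1) k] \<gamma> y(2) x by force
    qed
    moreover have "F x = 0" using x by (simp add: F_def)
    ultimately show ?thesis by (simp add: D_def)
  qed
  have "in_D F"
    unfolding in_D_def
  proof
    fix \<gamma> assume \<gamma>: "\<gamma> \<in> K"
    \<comment> \<open>After multiplication by m \<gamma> the sum is at most one of the summands that
      make up the energy of h n. Summing the bounds over n gives 2 / m \<gamma>.\<close>
    have piece: "(\<Sum>x\<in>B. cmod (D F \<gamma> x) powr p) \<le> (1 / 2) ^ n / m \<gamma>" if B: "finite B" "B \<subseteq> T n" for B n
    proof -
      have "(\<Sum>x\<in>B. cmod (D F \<gamma> x) powr p) = (\<Sum>x\<in>B. cmod (D (h n) \<gamma> x) powr p)"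
        using B D_T[OF \<gamma>] by (intro sum.cong) auto
      also have "\<dots> \<le> psum (D (h n) \<gamma>)"
        unfolding psum_def using B TG[of n] lp_D[OF lp_h K_carrier[OF \<gamma>]]
        by (intro finite_sum_le_infsum) auto
      finally have "m \<gamma> * (\<Sum>x\<in>B. cmod (D F \<gamma> x) powr p) \<le> m \<gamma> * psum (D (h n) \<gamma>)"
        using m_pos[OF \<gamma>] by (intro mult_left_mono) auto
      also have "\<dots> \<le> (\<Sum>\<gamma>\<in>K. m \<gamma> * psum (D (h n) \<gamma>))"
        using finite_K \<gamma> m_pos by (intro member_le_sum) (auto simp: psum_nonneg less_imp_le)
      also have "\<dots> \<le> (1 / 2) ^ n"
        using energy_h[of n] energy_eq[OF in_D_lp[OF lp_h], of n] by simp
      finally show ?thesis using m_pos[OF \<gamma>] by (simp add: pos_le_divide_eq mult.commute)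
    qed
    have "(\<Sum>x\<in>A. cmod (D F \<gamma> x) powr p) \<le> 2 / m \<gamma>" if A: "finite A" "A \<subseteq> carrier G" for A
    proof -
      define A' where "A' = {x \<in> A. \<exists>n. x \<in> T n}"
      have A': "finite A'" using A by (simp add: A'_def)
      have "(\<Sum>x\<in>A. cmod (D F \<gamma> x) powr p) = (\<Sum>x\<in>A'. cmod (D F \<gamma> x) powr p)"
        using A D_out[OF \<gamma>] by (intro sum.mono_neutral_right) (auto simp: A'_def)
      also have "\<dots> = (\<Sum>n\<in>idx ` A'. \<Sum>x\<in>{x \<in> A'. idx x = n}. cmod (D F \<gamma> x) powr p)"
        using A' by (intro sum.group[symmetric]) auto
      also have "\<dots> \<le> (\<Sum>n\<in>idx ` A'. (1 / 2) ^ n / m \<gamma>)"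
        using A idx by (intro sum_mono piece) (auto simp: A'_def)
      also have "\<dots> = (\<Sum>n\<in>idx ` A'. (1 / 2) ^ n) / m \<gamma>"
        by (simp add: sum_divide_distrib)
      also have "\<dots> \<le> 2 / m \<gamma>"
      proof (intro divide_right_mono)
        have "(\<Sum>n\<in>idx ` A'. (1 / 2 :: real) ^ n) \<le> suminf (\<lambda>n. (1 / 2) ^ n)"
          using A' by (intro sum_le_suminf) auto
        also have "\<dots> = 2" by (simp add: suminf_geometric)
        finally show "(\<Sum>n\<in>idx ` A'. (1 / 2 :: real) ^ n) \<le> 2" .
      qed (use m_pos[OF \<gamma>] in simp)
      finally show ?thesis .
    qed
    then show "lp (D F \<gamma>)" by (intro nonneg_finite_sums_bounded(1)) auto
  qed
  moreover have "\<not> lp (\<lambda>x. F x - c)" for c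
  proof
    assume lp: "lp (\<lambda>x. F x - c)"
    \<comment> \<open>The amount that each region is guaranteed to contribute; k disjoint regions
      give k \<delta>, which is unbounded.\<close>
    define \<delta> where "\<delta> = (if c = 0 then 1 else cmod c powr p)"
    have "\<delta> > 0" by (simp add: \<delta>_def)
    have piece: "\<delta> \<le> (\<Sum>x\<in>T n. cmod (F x - c) powr p)" for n
    proof (cases "c = 0")
      case True
      have "psum (h n) = (\<Sum>x\<in>T n. cmod (h n x) powr p)"
        by (rule psum_finite_support[OF fin TG]) (use supp[of _ n] in auto)
      also have "\<dots> = (\<Sum>x\<in>T n. cmod (F x) powr p)"
        using F_T by (intro sum.cong) auto
      finally show ?thesis using True psum_h by (simp add: \<delta>_def)
    next
      case False
      obtain z where z: "z \<in> T n" "h n z = 0" using zero by blast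
      then have "cmod c powr p = cmod (F z - c) powr p" using F_T by simp
      also have "\<dots> \<le> (\<Sum>x\<in>T n. cmod (F x - c) powr p)"
        using fin z by (intro member_le_sum) auto
      finally show ?thesis using False by (simp add: \<delta>_def)
    qed
    have "real k * \<delta> \<le> psum (\<lambda>x. F x - c)" for k
    proof -
      have "real k * \<delta> \<le> (\<Sum>n<k. \<Sum>x\<in>T n. cmod (F x - c) powr p)"
        using sum_mono[of "{..<k}" "\<lambda>_. \<delta>" "\<lambda>n. \<Sum>x\<in>T n. cmod (F x - c) powr p"] piece by simp
      also have "\<dots> = (\<Sum>x\<in>(\<Union>n<k. T n). cmod (F x - c) powr p)"
        using fin uniq by (intro sum.UNION_disjoint[symmetric]) auto
      also have "\<dots> \<le> psum (\<lambda>x. F x - c)"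
        unfolding psum_def using fin TG lp by (intro finite_sum_le_infsum) auto
      finally show ?thesis .
    qed
    then show False using \<open>\<delta> > 0\<close> reals_Archimedean3[of \<delta>] by (meson not_le)
  qed
  ultimately show thesis by (rule that)
qed

text \<open>If no constant works, the constants 2^n give functions of p-norm 1 and energy at most
  2^-n. Moved to disjoint places they form a Dirichlet finite function that violates
  \<open>decomp\<close>.\<close>

lemma Poincare_finite_support:
  assumes decomp: "\<And>F. in_D F \<Longrightarrow> \<exists>c. lp (\<lambda>x. F x - c)"
  obtains C where "C > 0" "\<And>A u. finite A \<Longrightarrow> A \<subseteq> carrier G \<Longrightarrow> (\<And>x. x \<in> carrier G - A \<Longrightarrow> u x = 0) \<Longrightarrow> psum u \<le> C * energy u"
proof (rule ccontr)
  assume "\<not> thesis"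
  then have ex: "\<exists>A u. finite A \<and> A \<subseteq> carrier G \<and> (\<forall>x\<in>carrier G - A. u x = 0) \<and> psum u > C * energy u" if "C > 0" for C
    using that \<open>\<And>C. C > 0 \<Longrightarrow> (\<And>A u. finite A \<Longrightarrow> A \<subseteq> carrier G \<Longrightarrow> (\<And>x. x \<in> carrier G - A \<Longrightarrow> u x = 0) \<Longrightarrow> psum u \<le> C * energy u) \<Longrightarrow> thesis\<close>
    by (meson not_le)
  have normalized: "\<exists>A u. finite A \<and> A \<subseteq> carrier G \<and> (\<forall>x\<in>carrier G - A. u x = 0) \<and> psum u = 1 \<and> energy u \<le> (1 / 2) ^ n" for n
  proof -
    obtain A u where A: "finite A" "A \<subseteq> carrier G" "\<forall>x\<in>carrier G - A. u x = 0" and less: "psum u > 2 ^ n * energy u"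
      using ex[of "2 ^ n"] by auto
    have pos: "psum u > 0"
      using less mult_nonneg_nonneg[OF _ energy_nonneg[of u], of "2 ^ n"] by simp
    \<comment> \<open>Scaling by this factor divides both \<open>psum\<close> and
      \<open>energy\<close> by \<open>psum u\<close>.\<close>
    let ?c = "psum u powr - (1 / p)"
    have "\<bar>?c\<bar> powr p = psum u powr - 1"
      using p by (simp add: powr_powr)
    then have c: "\<bar>?c\<bar> powr p = 1 / psum u"
      using pos by (simp add: powr_minus divide_inverse)
    have "energy (\<lambda>x. of_real ?c * u x) \<le> (1 / 2) ^ n"
      unfolding energy_scale c using less pos by (simp add: field_simps power_divide)
    moreover have "psum (\<lambda>x. of_real ?c * u x) = 1"
      unfolding psum_scale c using pos by simp
    ultimately show ?thesis using A by (intro exI[of _ A] exI[of _ "\<lambda>x. of_real ?c * u x"]) auto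
  qed
  \<comment> \<open>The pair r consists of a bump and its region. The n-th region has to avoid all
    earlier ones, so the choice depends on the whole history H.\<close>
  define P where "P H n r \<longleftrightarrow> finite (snd r) \<and> snd r \<subseteq> carrier G \<and> (\<forall>k<n. snd r \<inter> snd (H k) = {})
      \<and> (\<forall>x\<in>carrier G. fst r x \<noteq> 0 \<longrightarrow> x \<in> snd r \<and> (\<forall>\<gamma>\<in>K. \<gamma> \<otimes> x \<in> snd r)) \<and> (\<exists>z\<in>snd r. fst r z = 0)
      \<and> psum (fst r) = 1 \<and> energy (fst r) \<le> (1 / 2) ^ n"
    for H :: "nat \<Rightarrow> ('a \<Rightarrow> complex) \<times> 'a set" and n r
  have "\<exists>H. \<forall>n. P H n (H n)"
  proof (rule dependent_wellorder_choice)
    show "P H n r = P H' n r" if "\<And>k. k < n \<Longrightarrow> H k = H' k" for H H' n r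
      using that by (simp add: P_def)
    fix n and H :: "nat \<Rightarrow> ('a \<Rightarrow> complex) \<times> 'a set" assume IH: "\<And>k. k < n \<Longrightarrow> P H k (H k)"
    obtain A u where A: "finite A" "A \<subseteq> carrier G" and u: "\<And>x. x \<in> carrier G - A \<Longrightarrow> u x = 0"
      and norm: "psum u = 1" "energy u \<le> (1 / 2) ^ n"
      using normalized[of n] by blast
    \<comment> \<open>A point outside the support, added to the region to supply the zero of the
      bump that excludes nonzero constants c.\<close>
    obtain z where z: "z \<in> carrier G" "z \<notin> A"
      using infinite_G A by (metis finite_subset subsetI)
    define T where "T = insert z (A \<union> (\<lambda>(\<gamma>, x). \<gamma> \<otimes> x) ` (K \<times> A))"
    have T: "finite T" "T \<subseteq> carrier G"
      using A z finite_K K_carrier by (auto simp: T_def)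
    define U where "U = (\<Union>k<n. snd (H k))"
    have "finite (snd (H k)) \<and> snd (H k) \<subseteq> carrier G" if "k < n" for k
      using IH[OF that] by (simp add: P_def)
    then have U: "finite U" "U \<subseteq> carrier G" by (auto simp: U_def)
    obtain g where g: "g \<in> carrier G" "(\<lambda>t. t \<otimes> g) ` T \<inter> U = {}"
      using translate_avoid[OF infinite_G T U] .
    let ?T = "(\<lambda>t. t \<otimes> g) ` T" and ?u = "\<lambda>x. u (x \<otimes> inv g)"
    have in_T: "x \<in> ?T" if "x \<in> carrier G" "x \<otimes> inv g \<in> T" for x
      using that g by (intro image_eqI[of _ _ "x \<otimes> inv g"]) (auto simp: m_assoc)
    have supp: "x \<in> ?T \<and> (\<forall>\<gamma>\<in>K. \<gamma> \<otimes> x \<in> ?T)" if x: "x \<in> carrier G" "?u x \<noteq> 0" for x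
    proof -
      have xA: "x \<otimes> inv g \<in> A" using u[of "x \<otimes> inv g"] x g by auto
      have "\<gamma> \<otimes> x \<in> ?T" if "\<gamma> \<in> K" for \<gamma>
      proof (rule in_T)
        have "\<gamma> \<otimes> x \<otimes> inv g = \<gamma> \<otimes> (x \<otimes> inv g)" using that x g K_carrier by (simp add: m_assoc)
        then show "\<gamma> \<otimes> x \<otimes> inv g \<in> T" using that xA by (auto simp: T_def)
      qed (use that x K_carrier in simp)
      moreover have "x \<in> ?T" using xA x by (intro in_T) (simp_all add: T_def)
      ultimately show ?thesis by blast
    qed
    have "\<exists>z\<in>?T. ?u z = 0"
    proof (rule bexI)
      show "z \<otimes> g \<in> ?T" by (simp add: T_def)
      have "z \<otimes> g \<otimes> inv g = z" using z g by (simp add: m_assoc)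
      then show "?u (z \<otimes> g) = 0" using u z by simp
    qed
    moreover have "psum ?u = 1" "energy ?u \<le> (1 / 2) ^ n"
      using norm g by (simp_all add: psum_translate_right energy_translate_right)
    moreover have "finite ?T" "?T \<subseteq> carrier G" using T g by auto
    moreover have "\<forall>k<n. ?T \<inter> snd (H k) = {}" using g by (auto simp: U_def)
    ultimately have "P H n (?u, ?T)" using supp unfolding P_def fst_conv snd_conv by blast
    then show "\<exists>r. P H n r" by blast
  qed
  then obtain H where H: "\<And>n. P H n (H n)" by blast
  obtain F where "in_D F" "\<And>c. \<not> lp (\<lambda>x. F x - c)"
    by (rule sum_of_disjoint_bumps[of "\<lambda>n. snd (H n)" "\<lambda>n. fst (H n)"]) (use H in \<open>auto simp: P_def\<close>)
  then show False using decomp by blast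
qed

text \<open>Extension from finite supports by truncation: the tail w has small p-norm, hence small
  energy, so cutting it off costs little. The constant grows by \<open>2 powr p\<close> from
  \<open>energy_add_le\<close>.\<close>

lemma Poincare:
  assumes "\<And>F. in_D F \<Longrightarrow> \<exists>c. lp (\<lambda>x. F x - c)"
  obtains C where "C > 0" "\<And>f. lp f \<Longrightarrow> psum f \<le> C * energy f"
proof -
  obtain C where C: "C > 0" and le: "\<And>A u. finite A \<Longrightarrow> A \<subseteq> carrier G \<Longrightarrow> (\<And>x. x \<in> carrier G - A \<Longrightarrow> u x = 0) \<Longrightarrow> psum u \<le> C * energy u"
    using Poincare_finite_support[OF assms] by blast
  \<comment> \<open>The total coefficient of \<delta> in the final estimate: 1 from the truncated
    norm, the rest from the energy of the tail.\<close>
  define c1 where "c1 = 1 + C * (2 powr p * (2 powr p * 2))"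
  have c1: "c1 > 0" using C by (simp add: c1_def add_pos_nonneg)
  have "psum f \<le> C * 2 powr p * energy f" if f: "lp f" for f
  proof (rule field_le_epsilon)
    fix e :: real assume e: "e > 0"
    define \<delta> where "\<delta> = e / c1"
    obtain A where A: "finite A" "A \<subseteq> carrier G" and "dist (\<Sum>x\<in>A. cmod (f x) powr p) (psum f) \<le> \<delta>"
      using infsum_finite_approximation[OF f, of \<delta>] e c1 by (auto simp: psum_def \<delta>_def)
    then have close: "psum f \<le> (\<Sum>x\<in>A. cmod (f x) powr p) + \<delta>" by (simp add: dist_real_def)
    define u w where "u x = (if x \<in> A then f x else 0)" and "w x = (if x \<in> A then 0 else f x)" for x
    have u0: "\<And>x. x \<in> carrier G - A \<Longrightarrow> u x = 0" by (simp add: u_def)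
    have psum_u: "psum u = (\<Sum>x\<in>A. cmod (f x) powr p)"
      using psum_finite_support[where u = u, OF A u0] by (simp add: u_def)
    have w: "lp w"
      by (rule summable_on_comparison_test[OF f]) (auto simp: w_def)
    have lpu: "lp u" by (rule lp_finite_support[OF A(1) u0])
    have "psum f = psum u + psum w"
    proof -
      have "cmod (f x) powr p = cmod (u x) powr p + cmod (w x) powr p" for x
        by (simp add: u_def w_def)
      then show ?thesis unfolding psum_def using infsum_add[OF lpu w] by simp
    qed
    with close psum_u have psum_w: "psum w \<le> \<delta>" by simp
    have nw: "lp (\<lambda>x. - w x)" "psum (\<lambda>x. - w x) = psum w" using w by (simp_all add: psum_def)
    have "energy u = energy (\<lambda>x. f x + - w x)"
      by (rule energy_cong) (simp add: u_def w_def)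
    also have "\<dots> \<le> 2 powr p * (energy f + energy (\<lambda>x. - w x))"
      by (rule energy_add_le[OF in_D_lp[OF f] in_D_lp[OF nw(1)]])
    also have "\<dots> \<le> 2 powr p * (energy f + 2 powr p * 2 * \<delta>)"
    proof (intro mult_left_mono add_left_mono)
      show "energy (\<lambda>x. - w x) \<le> 2 powr p * 2 * \<delta>"
        using order_trans[OF energy_lp_le[OF nw(1)], of "2 powr p * 2 * \<delta>"] psum_w by (simp add: nw(2))
    qed simp
    finally have "energy u \<le> 2 powr p * (energy f + 2 powr p * 2 * \<delta>)" .
    then have "C * energy u \<le> C * (2 powr p * (energy f + 2 powr p * 2 * \<delta>))"
      using C by simp
    with le[OF A, of u, OF u0] close psum_u
    have "psum f \<le> \<delta> + C * (2 powr p * (energy f + 2 powr p * 2 * \<delta>))" by simp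
    also have "\<dots> = C * 2 powr p * energy f + c1 * \<delta>"
      by (simp add: c1_def distrib_left distrib_right mult_ac)
    finally show "psum f \<le> C * 2 powr p * energy f + e" using c1 by (simp add: \<delta>_def)
  qed
  then show thesis using C by (intro that[of "C * 2 powr p"]) auto
qed

subsection \<open>Cocycles and fixed points\<close>

definition all_fixed :: bool
  where "all_fixed \<longleftrightarrow> (\<forall>\<alpha>\<in>affine_actions G p. \<exists>f\<in>ell G p. \<forall>\<gamma>\<in>carrier G. \<alpha> \<gamma> f = f)"

text \<open>The identity D F (a b) (x) = D F b (a^-1 x) + D F a (x) and the translation invariance
  of l^p carry membership from K to all products of its elements.\<close>

lemma lp_D_carrier:
  assumes F: "in_D F" and \<gamma>: "\<gamma> \<in> carrier G"
  shows "lp (D F \<gamma>)"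
proof -
  have "lp (D F \<gamma>)" if "\<gamma> \<in> generate G K"
    using that
  proof (induction rule: generate.induct)
    case one
    have "lp (D F \<one>) \<longleftrightarrow> lp (\<lambda>x. 0)" by (rule lp_cong) (simp add: D_def)
    then show ?case by simp
  next
    case (incl h)
    then show ?case using F by (simp add: in_D_def)
  next
    case (inv h)
    then show ?case using F inv_in_K by (simp add: in_D_def)
  next
    case (eng a b)
    then have ab: "a \<in> carrier G" "b \<in> carrier G" using K_gen by auto
    have "lp (D F (a \<otimes> b)) \<longleftrightarrow> lp (\<lambda>x. D F b (inv a \<otimes> x) + D F a x)"
      using ab by (intro lp_cong) (simp add: D_def inv_mult_group m_assoc)
    moreover have "lp (\<lambda>x. D F b (inv a \<otimes> x))"
      using psum_translate(1)[of "inv a" "D F b"] ab eng.IH by simp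
    then have "lp (\<lambda>x. D F b (inv a \<otimes> x) + D F a x)"
      using eng.IH p by (intro summable_on_powr_add) auto
    ultimately show ?case by simp
  qed
  then show ?thesis using \<gamma> K_gen by simp
qed

text \<open>The cocycle is the formal coboundary of F. It takes values in l^p although F itself need
  not lie there. Conceptually, the action is translation of l^p conjugated by adding F.\<close>

lemma affine_action_of_dirichlet:
  assumes F: "in_D F"
  shows "(\<lambda>\<gamma>. \<lambda>f\<in>ell G p. \<lambda>x\<in>carrier G. left_reg G \<gamma> f x + D F \<gamma> x) \<in> affine_actions G p"
proof -
  define \<alpha> where "\<alpha> = (\<lambda>\<gamma>. \<lambda>f\<in>ell G p. \<lambda>x\<in>carrier G. left_reg G \<gamma> f x + D F \<gamma> x)"
  define c where "c = (\<lambda>\<gamma>. restrict (D F \<gamma>) (carrier G))"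
  have \<alpha>_apply: "\<alpha> \<gamma> f x = f (inv \<gamma> \<otimes> x) + D F \<gamma> x" if "f \<in> ell G p" "x \<in> carrier G" for \<gamma> f x
    using that by (simp add: \<alpha>_def left_reg_def)
  have \<alpha>_ext: "\<alpha> \<gamma> f \<in> extensional (carrier G)" if "f \<in> ell G p" for \<gamma> f
    using that by (simp add: \<alpha>_def)
  have closed: "\<alpha> \<gamma> f \<in> ell G p" if "\<gamma> \<in> carrier G" "f \<in> ell G p" for \<gamma> f
  proof -
    have "lp (\<lambda>x. f (inv \<gamma> \<otimes> x) + D F \<gamma> x)"
      using that p psum_translate(1)[of "inv \<gamma>" f] lp_D_carrier[OF F]
      by (intro summable_on_powr_add) (auto simp: ell_iff)
    moreover have "\<alpha> \<gamma> f = restrict (\<lambda>x. f (inv \<gamma> \<otimes> x) + D F \<gamma> x) (carrier G)"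
      using that by (auto simp: \<alpha>_def left_reg_def)
    ultimately show ?thesis by (simp only: restrict_ell)
  qed
  have mult: "\<alpha> (a \<otimes> b) f = \<alpha> a (\<alpha> b f)" if "a \<in> carrier G" "b \<in> carrier G" "f \<in> ell G p" for a b f
    using that closed \<alpha>_ext
    by (intro extensionalityI[of _ "carrier G"]) (auto simp: \<alpha>_apply D_def inv_mult_group m_assoc)
  have one: "\<alpha> \<one> f = f" if "f \<in> ell G p" for f
    using that \<alpha>_ext by (intro extensionalityI[of _ "carrier G"]) (auto simp: \<alpha>_apply D_def ell_iff)
  \<comment> \<open>The laws \<open>mult\<close> and \<open>one\<close> make the map for \<gamma>^-1
    a two-sided inverse. \<open>Bij\<close> also requires extensionality on l^p, which is why
    \<alpha> \<gamma> is a restricted function.\<close>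
  have Bij: "\<alpha> \<gamma> \<in> Bij (ell G p)" if "\<gamma> \<in> carrier G" for \<gamma>
  proof -
    have "bij_betw (\<alpha> \<gamma>) (ell G p) (ell G p)"
      by (rule bij_betw_byWitness[where f' = "\<alpha> (inv \<gamma>)"])
        (use that closed in \<open>auto simp: mult[symmetric] one\<close>)
    then show ?thesis by (simp add: Bij_def \<alpha>_def)
  qed
  have "group_action G (ell G p) \<alpha>"
    unfolding group_action_def group_hom_def group_hom_axioms_def
  proof (intro conjI group_BijGroup homI)
    show "group G" by (rule group_axioms)
    show "\<alpha> \<gamma> \<in> carrier (BijGroup (ell G p))" if "\<gamma> \<in> carrier G" for \<gamma>
      using Bij[OF that] by (simp add: BijGroup_def)
    show "\<alpha> (a \<otimes> b) = \<alpha> a \<otimes>\<^bsub>BijGroup (ell G p)\<^esub> \<alpha> b" if "a \<in> carrier G" "b \<in> carrier G" for a b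
    proof -
      have "\<alpha> (a \<otimes> b) = compose (ell G p) (\<alpha> a) (\<alpha> b)"
      proof (rule extensionalityI[of _ "ell G p"])
        show "\<alpha> (a \<otimes> b) \<in> extensional (ell G p)" by (simp add: \<alpha>_def)
      qed (simp_all add: compose_def mult that)
      then show ?thesis using Bij that by (simp add: BijGroup_def)
    qed
  qed
  moreover have "c \<in> cocycles G p"
    unfolding cocycles_def
  proof (intro CollectI conjI ballI funcsetI)
    show "c \<gamma> \<in> ell G p" if "\<gamma> \<in> carrier G" for \<gamma>
      using lp_D_carrier[OF F that] by (simp only: c_def restrict_ell)
    show "c (a \<otimes> b) = (\<lambda>x\<in>carrier G. left_reg G a (c b) x + c a x)" if "a \<in> carrier G" "b \<in> carrier G" for a b
      using that by (auto simp: c_def left_reg_def D_def inv_mult_group m_assoc)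
  qed
  moreover have "\<alpha> \<gamma> f = (\<lambda>x\<in>carrier G. left_reg G \<gamma> f x + c \<gamma> x)" if "f \<in> ell G p" for \<gamma> f
    using that by (auto simp: \<alpha>_def c_def)
  ultimately show ?thesis
    unfolding affine_actions_def \<alpha>_def[symmetric] by blast
qed

text \<open>A fixed point f makes F + f invariant under left translation, hence constant.
  Concretely, the fixed point equation for the group element x is evaluated at the point x.\<close>

lemma decomposition_if_fixed:
  assumes all_fixed and F: "in_D F"
  shows "\<exists>c. lp (\<lambda>x. F x - c)"
proof -
  obtain f where f: "f \<in> ell G p" and fixed: "\<And>\<gamma>. \<gamma> \<in> carrier G \<Longrightarrow>
      (\<lambda>x\<in>carrier G. left_reg G \<gamma> f x + D F \<gamma> x) = f"
    using assms(1) affine_action_of_dirichlet[OF F] unfolding all_fixed_def by fastforce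
  have "F x - (f \<one> + F \<one>) = - f x" if x: "x \<in> carrier G" for x
  proof -
    have "left_reg G x f x + D F x x = f x" using fun_cong[OF fixed[OF x], of x] x by simp
    then have "f \<one> + (F \<one> - F x) = f x" using x by (simp add: left_reg_def D_def)
    then show ?thesis by (simp add: algebra_simps)
  qed
  then have "lp (\<lambda>x. F x - (f \<one> + F \<one>)) \<longleftrightarrow> lp (\<lambda>x. - f x)"
    by (intro lp_cong) simp
  then show ?thesis using f by (auto simp: ell_iff)
qed

section \<open>The two implications between fixed points and the lower bound on the
  Laplacian\<close>

lemma lap_bound_if_fixed:
  assumes all_fixed
  obtains C where "C > 0" "\<And>f. in_D f \<Longrightarrow>
    (\<Sum>\<^sub>\<infinity>x\<in>carrier G. cmod (lap f x) powr q) powr (1 / q) \<ge> C * energy f powr (1 - 1 / p)"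
proof -
  obtain C where C: "C > 0" and le: "\<And>f. lp f \<Longrightarrow> psum f \<le> C * energy f"
    using Poincare[OF decomposition_if_fixed[OF assms]] by blast
  \<comment> \<open>The 2 comes from Green's formula and C powr (1 / p) from the Poincare inequality
    for the p-norm itself.\<close>
  let ?C = "1 / (2 * C powr (1 / p))"
  have "(\<Sum>\<^sub>\<infinity>x\<in>carrier G. cmod (lap f x) powr q) powr (1 / q) \<ge> ?C * energy f powr (1 - 1 / p)" if f: "in_D f" for f
  proof (cases "energy f = 0")
    case False
    then have pos: "energy f > 0" using energy_nonneg[of f] by simp
    obtain c where c: "lp (\<lambda>x. f x - c)" using decomposition_if_fixed[OF assms f] by blast
    \<comment> \<open>Gradient, energy and Laplacian do not see constants, so the estimates for l^p
      functions transfer from h to f.\<close>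
    define h where "h x = f x - c" for x
    have h: "lp h" using c by (simp add: h_def)
    have D: "D h \<gamma> x = D f \<gamma> x" for \<gamma> x by (simp add: D_def h_def)
    have e: "energy h = energy f" by (simp add: energy_def edens_def D)
    have l: "lap h x = lap f x" for x by (simp add: lap_def flux_def D)
    let ?L = "(\<Sum>\<^sub>\<infinity>x\<in>carrier G. cmod (lap f x) powr q) powr (1 / q)"
    have "energy f \<le> 2 * ?L * psum h powr (1 / p)"
      using energy_le_lap[OF h] by (simp add: e l)
    also have "\<dots> \<le> 2 * ?L * (C * energy f) powr (1 / p)"
      using le[OF h] p by (intro mult_left_mono powr_mono2) (auto simp: e psum_nonneg)
    also have "\<dots> = (2 * C powr (1 / p) * ?L) * energy f powr (1 / p)"
      by (simp add: powr_mult)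
    finally have "energy f / energy f powr (1 / p) \<le> 2 * C powr (1 / p) * ?L"
      using pos by (simp add: pos_divide_le_eq)
    then have "energy f powr (1 - 1 / p) \<le> 2 * C powr (1 / p) * ?L"
      using pos by (simp add: powr_diff)
    then show ?thesis using C by (simp add: pos_divide_le_eq mult_ac)
  qed simp
  then show thesis using C by (intro that[of ?C]) auto
qed

lemma fixed_if_lap_bound:
  assumes C: "C > 0" and bound: "\<And>f. f \<in> dirichlet_space G K p \<Longrightarrow>
    (\<Sum>\<^sub>\<infinity>x\<in>carrier G. cmod (lap f x) powr q) powr (1 / q) \<ge> C * energy f powr (1 - 1 / p)"
  shows all_fixed
  unfolding all_fixed_def
proof
  fix \<alpha> assume "\<alpha> \<in> affine_actions G p"
  then obtain c where c: "c \<in> cocycles G p"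
    and \<alpha>: "\<And>\<gamma> f. \<gamma> \<in> carrier G \<Longrightarrow> f \<in> ell G p \<Longrightarrow> \<alpha> \<gamma> f = (\<lambda>x\<in>carrier G. left_reg G \<gamma> f x + c \<gamma> x)"
    by (auto simp: affine_actions_def)
  define F where "F x = - c x x" for x
  \<comment> \<open>Evaluate the cocycle identity for \<open>x = \<gamma> (\<gamma>\<^sup>-\<^sup>1 x)\<close> at the point \<open>x\<close>.\<close>
  have DF: "D F \<gamma> x = c \<gamma> x" if g: "\<gamma> \<in> carrier G" "x \<in> carrier G" for \<gamma> x
  proof -
    have "c (\<gamma> \<otimes> (inv \<gamma> \<otimes> x)) = (\<lambda>y\<in>carrier G. left_reg G \<gamma> (c (inv \<gamma> \<otimes> x)) y + c \<gamma> y)"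
      using c g unfolding cocycles_def by blast
    then have "c x x = c (inv \<gamma> \<otimes> x) (inv \<gamma> \<otimes> x) + c \<gamma> x"
      using g by (simp add: m_assoc[symmetric] left_reg_def)
    then show ?thesis by (simp add: D_def F_def)
  qed
  have F: "in_D F"
    unfolding in_D_def
  proof
    fix \<gamma> assume "\<gamma> \<in> K"
    then have g: "\<gamma> \<in> carrier G" by (rule K_carrier)
    then have "lp (c \<gamma>)" using c by (auto simp: cocycles_def ell_iff)
    then show "lp (D F \<gamma>)" using lp_cong[of "D F \<gamma>" "c \<gamma>"] DF g by simp
  qed
  obtain h where h: "h \<in> ell G p" and slope: "energy (\<lambda>x. F x + h x) > 0 \<Longrightarrow>
      (\<Sum>\<^sub>\<infinity>x\<in>carrier G. cmod (lap (\<lambda>x. F x + h x) x) powr q) powr (1 / q)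
        \<le> C / 2 * energy (\<lambda>x. F x + h x) powr (1 - 1 / p)"
    using exists_small_slope[OF F C] by blast
  define f where "f = (\<lambda>x. F x + h x)"
  have f: "in_D f" unfolding f_def using h by (intro in_D_add F in_D_lp) (simp add: ell_iff)
  \<comment> \<open>At positive energy E the hypothesis makes the norm of the Laplacian at least C
    E^(1 - 1/p), while the choice of h makes it at most half of that.\<close>
  have "energy f = 0"
  proof (rule ccontr)
    assume "energy f \<noteq> 0"
    then have pos: "energy f > 0" using energy_nonneg[of f] by simp
    let ?f = "restrict f (carrier G)"
    have "in_D ?f" using f in_D_cong[of ?f f] by simp
    then have "?f \<in> dirichlet_space G K p" by (simp add: dirichlet_space_iff)
    from bound[OF this] have "C * energy ?f powr (1 - 1 / p) \<le> (\<Sum>\<^sub>\<infinity>x\<in>carrier G. cmod (lap ?f x) powr q) powr (1 / q)" .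
    moreover have "energy ?f = energy f" by (rule energy_cong) simp
    moreover have "(\<Sum>\<^sub>\<infinity>x\<in>carrier G. cmod (lap ?f x) powr q) = (\<Sum>\<^sub>\<infinity>x\<in>carrier G. cmod (lap f x) powr q)"
      using lap_cong[of ?f f] by (intro infsum_cong) simp
    ultimately have "C * energy f powr (1 - 1 / p) \<le> C / 2 * energy f powr (1 - 1 / p)"
      using slope pos unfolding f_def by simp
    moreover have "energy f powr (1 - 1 / p) > 0" using pos by simp
    ultimately show False using C by simp
  qed
  then have const: "f x = f \<one>" if "x \<in> carrier G" for x
    using constant_if_energy_zero[OF f _ that] by blast
  have "\<alpha> \<gamma> h = h" if g: "\<gamma> \<in> carrier G" for \<gamma>
  proof -
    \<comment> \<open>This is the vanishing of D (F + h) \<gamma>, with D F \<gamma> replaced by the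
      cocycle.\<close>
    have "h (inv \<gamma> \<otimes> x) + c \<gamma> x = h x" if x: "x \<in> carrier G" for x
    proof -
      have "f (inv \<gamma> \<otimes> x) = f x" using const[of x] const[of "inv \<gamma> \<otimes> x"] g x by simp
      then show ?thesis
        unfolding DF[OF g x, symmetric] D_def f_def by (simp add: algebra_simps)
    qed
    then show ?thesis
      unfolding \<alpha>[OF g h] using h
      by (intro extensionalityI[of _ "carrier G"]) (auto simp: left_reg_def ell_iff)
  qed
  then show "\<exists>f\<in>ell G p. \<forall>\<gamma>\<in>carrier G. \<alpha> \<gamma> f = f" using h by blast
qed

lemma ell_norm_p_laplacian:
  "ell_norm G q (p_laplacian G K m p f) = (\<Sum>\<^sub>\<infinity>x\<in>carrier G. cmod (lap f x) powr q) powr (1 / q)"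
proof -
  have "(\<Sum>\<^sub>\<infinity>x\<in>carrier G. cmod (p_laplacian G K m p f x) powr q) = (\<Sum>\<^sub>\<infinity>x\<in>carrier G. cmod (lap f x) powr q)"
    by (intro infsum_cong) (simp add: p_laplacian_eq)
  then show ?thesis by (simp add: ell_norm_def)
qed

lemma dirichlet_norm_powr:
  assumes "f \<in> dirichlet_space G K p"
  shows "dirichlet_norm G K m p f powr (p - 1) = energy f powr (1 - 1 / p)"
proof -
  have "1 / p * (p - 1) = 1 - 1 / p" using p by (simp add: field_simps)
  then show ?thesis using assms by (simp add: dirichlet_space_iff dirichlet_norm_eq powr_powr)
qed

theorem all_fixed_iff:
  "all_fixed \<longleftrightarrow> (\<exists>C>0. \<forall>f\<in>dirichlet_space G K p.
     ell_norm G q (p_laplacian G K m p f) \<ge> C * dirichlet_norm G K m p f powr (p - 1))"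
proof
  assume all_fixed
  then obtain C where "C > 0" "\<And>f. in_D f \<Longrightarrow>
    (\<Sum>\<^sub>\<infinity>x\<in>carrier G. cmod (lap f x) powr q) powr (1 / q) \<ge> C * energy f powr (1 - 1 / p)"
    using lap_bound_if_fixed by blast
  then show "\<exists>C>0. \<forall>f\<in>dirichlet_space G K p.
     ell_norm G q (p_laplacian G K m p f) \<ge> C * dirichlet_norm G K m p f powr (p - 1)"
    by (intro exI[of _ C]) (auto simp: ell_norm_p_laplacian dirichlet_norm_powr dirichlet_space_iff)
next
  assume "\<exists>C>0. \<forall>f\<in>dirichlet_space G K p.
     ell_norm G q (p_laplacian G K m p f) \<ge> C * dirichlet_norm G K m p f powr (p - 1)"
  then show all_fixed
    using fixed_if_lap_bound by (auto simp: ell_norm_p_laplacian dirichlet_norm_powr)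
qed

end

theorem corollary1p4:
  fixes G :: "('a, 'b) monoid_scheme"
    and K :: "'a set"
    and m :: "'a \<Rightarrow> real"
    and p q :: real
  assumes "group G"
    and "infinite (carrier G)"
    and "finite K"
    and "K \<subseteq> carrier G"
    and "generate G K = carrier G"
    and "(\<lambda>\<gamma>. inv\<^bsub>G\<^esub> \<gamma>) ` K = K"
    and "symmetric_weight G K m"
    and "1 < p"
    and "q = p / (p - 1)"
  shows "(\<forall>\<alpha>\<in>affine_actions G p. \<exists>f\<in>ell G p. \<forall>\<gamma>\<in>carrier G. \<alpha> \<gamma> f = f)
    \<longleftrightarrow> (\<exists>C>0. \<forall>f\<in>dirichlet_space G K p.
          ell_norm G q (p_laplacian G K m p f) \<ge> C * dirichlet_norm G K m p f powr (p - 1))"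
proof -
  interpret dirichlet_setting G K m p q
    using assms by (simp add: dirichlet_setting_def dirichlet_setting_axioms_def)
  show ?thesis using all_fixed_iff unfolding all_fixed_def .
qed

end
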